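(* Let $H$ be a Hopf $*$-algebra over $\mathbb{C}$ and let $V,W$ be left $H$-modules. (a) The formula $a \rhd \bar v = \overline{S(a)^* \rhd v}$ ($a\in H$, $v\in V$) defines an action of $H$ on the complex conjugate vector space $\overline{V}$, i.e. $\overline{V}$ is a left $H$-module. (b) If $T : V \to W$ is an $H$-module map, then $\overline{T} : \overline{V} \to \overline{W}$ is also an $H$-module map. (c) Complex conjugation ($V \mapsto \overline{V}$, $T \mapsto \overline{T}$) is an endofunctor of the category $\mathbf{HMod}$ of left $H$-modules and $H$-module maps.
   Context: All vector spaces are over $\mathbb{C}$. A Hopf $*$-algebra is a Hopf algebra $H$ over $\mathbb{C}$ (coproduct $\Delta(a)=a_{(1)}\otimes a_{(2)}$, counit $\varepsilon$, antipode $S$) equipped with an antilinear map $*:H\to H$ such that $(a^* )^*=a$, $(ab)^*=b^*a^*$ and $\Delta(a^* )=a_{(1)}^*\otimes a_{(2)}^*$. The action of $a \in H$ on $v$ is written $a\rhd v$. For a vector space $V$, the complex conjugate vector space $\overline{V}$ consists of formal symbols $\bar v$ ($v\in V$) with $\bar v+\bar w=\overline{v+w}$ and $\lambda\cdot\bar v=\overline{\bar\lambda v}$; equivalently $c_V:V\to\overline V$, $v\mapsto\bar v$, is an antilinear bijection. For a linear map $T:V\to W$, $\overline T:\overline V\to\overline W$ is the linear map $\overline T(\bar v)=\overline{T(v)}$. *)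

theory Defs
  imports Complex_Main "HOL-Algebra.AbelCoset" "HOL-Algebra.Module" "HOL-Library.Poly_Mapping"
begin

section \<open>Complex vector spaces\<close>

text \<open>The field of complex numbers, also as a vector space over itself. A complex vector space is
  a structure \<open>V\<close> with \<open>Module.module complex_alg V\<close>. (The record of HOL-Algebra modules extends
  the one of rings; for a mere vector space the fields \<^const>\<open>monoid.mult\<close> and
  \<^const>\<open>monoid.one\<close> play no role.)\<close>

definition complex_alg :: "(complex, complex) module" where
  "complex_alg = \<lparr>carrier = UNIV, monoid.mult = (*), one = 1, zero = 0, add = (+), smult = (*)\<rparr>"

lemma field_complex_alg: "field complex_alg"
proof (rule cring.cring_fieldI2)
  have "\<exists>y. x + y = 0" for x :: complex
    by (rule exI[of _ "- x"]) simp
  then show "cring complex_alg"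
    by (intro cringI abelian_groupI comm_monoidI) (auto simp: complex_alg_def algebra_simps)
next
  fix a assume "a \<in> carrier complex_alg" "a \<noteq> \<zero>\<^bsub>complex_alg\<^esub>"
  then show "\<exists>b\<in>carrier complex_alg. a \<otimes>\<^bsub>complex_alg\<^esub> b = \<one>\<^bsub>complex_alg\<^esub>"
    by (auto simp: complex_alg_def intro: exI[of _ "1 / a"])
qed (simp add: complex_alg_def)

definition lin_hom ::
  "(complex, 'v, 'm) module_scheme \<Rightarrow> (complex, 'w, 'n) module_scheme \<Rightarrow> ('v \<Rightarrow> 'w) set" where
  "lin_hom V W = {f \<in> carrier V \<rightarrow> carrier W.
     (\<forall>x\<in>carrier V. \<forall>y\<in>carrier V. f (x \<oplus>\<^bsub>V\<^esub> y) = f x \<oplus>\<^bsub>W\<^esub> f y) \<and>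
     (\<forall>c. \<forall>x\<in>carrier V. f (c \<odot>\<^bsub>V\<^esub> x) = c \<odot>\<^bsub>W\<^esub> f x)}"

locale complex_algebra = A?: ring A + Module.module complex_alg A for A (structure) +
  assumes smult_mult_left:
      "\<lbrakk>x \<in> carrier A; y \<in> carrier A\<rbrakk> \<Longrightarrow> (c \<odot> x) \<otimes> y = c \<odot> (x \<otimes> y)"
    and smult_mult_right:
      "\<lbrakk>x \<in> carrier A; y \<in> carrier A\<rbrakk> \<Longrightarrow> x \<otimes> (c \<odot> y) = c \<odot> (x \<otimes> y)"


section \<open>The complex conjugate vector space\<close>

text \<open>The formal symbols are \<open>bar v\<close>, where \<open>bar\<close> is an arbitrary injection. Taking \<open>bar = id\<close>
  one gets the familiar model: the same abelian group with scalars acting through their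
  conjugates. As \<open>bar\<close> may map a type into itself, conjugation can be an \<^emph>\<open>endo\<close>functor.\<close>

definition conj_space ::
  "('v \<Rightarrow> 'w) \<Rightarrow> (complex, 'v, 'm) module_scheme \<Rightarrow> (complex, 'w) module" where
  "conj_space bar V =
    \<lparr>carrier = bar ` carrier V,
     monoid.mult = (\<lambda>x y. bar (the_inv bar x \<otimes>\<^bsub>V\<^esub> the_inv bar y)),
     one = bar \<one>\<^bsub>V\<^esub>,
     zero = bar \<zero>\<^bsub>V\<^esub>,
     add = (\<lambda>x y. bar (the_inv bar x \<oplus>\<^bsub>V\<^esub> the_inv bar y)),
     smult = (\<lambda>c x. bar (cnj c \<odot>\<^bsub>V\<^esub> the_inv bar x))\<rparr>"

lemma
  assumes "inj bar"
  shows conj_space_add: "bar v \<oplus>\<^bsub>conj_space bar V\<^esub> bar w = bar (v \<oplus>\<^bsub>V\<^esub> w)"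
    and conj_space_smult: "c \<odot>\<^bsub>conj_space bar V\<^esub> bar v = bar (cnj c \<odot>\<^bsub>V\<^esub> v)"
  using assms by (simp_all add: conj_space_def the_inv_f_f)

definition conj_map ::
  "('v \<Rightarrow> 'v') \<Rightarrow> ('w \<Rightarrow> 'w') \<Rightarrow> (complex, 'v, 'm) module_scheme \<Rightarrow> ('v \<Rightarrow> 'w) \<Rightarrow> ('v' \<Rightarrow> 'w')" where
  "conj_map bar bar' V T = (\<lambda>x \<in> carrier (conj_space bar V). bar' (T (the_inv bar x)))"

lemma conj_map_bar:
  assumes "inj bar" "v \<in> carrier V"
  shows "conj_map bar bar' V T (bar v) = bar' (T v)"
  using assms by (simp add: conj_map_def conj_space_def the_inv_f_f)


section \<open>Tensor products\<close>

text \<open>\<open>V \<otimes> W\<close> is the free vector space on \<open>V \<times> W\<close> modulo the bilinearity relations.\<close>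

definition free_space :: "'x set \<Rightarrow> (complex, 'x \<Rightarrow>\<^sub>0 complex) module" where
  "free_space X =
    \<lparr>carrier = {f. Poly_Mapping.keys f \<subseteq> X}, monoid.mult = undefined, one = undefined,
     zero = 0, add = (+), smult = (\<lambda>c. Poly_Mapping.map ((*) c))\<rparr>"

definition submodule_gen :: "(complex, 'v, 'm) module_scheme \<Rightarrow> 'v set \<Rightarrow> 'v set" where
  "submodule_gen V R = \<Inter>{N. submodule N complex_alg V \<and> R \<subseteq> N}"

definition quotient_space ::
  "(complex, 'v, 'm) module_scheme \<Rightarrow> 'v set \<Rightarrow> (complex, 'v set) module" where
  "quotient_space V N =
    \<lparr>carrier = a_rcosets\<^bsub>V\<^esub> N, monoid.mult = undefined, one = undefined,
     zero = N, add = set_add V, smult = (\<lambda>c X. \<Union>x\<in>X. N +>\<^bsub>V\<^esub> (c \<odot>\<^bsub>V\<^esub> x))\<rparr>"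

type_synonym ('v, 'w) tensor = "('v \<times> 'w \<Rightarrow>\<^sub>0 complex) set"

abbreviation free_tensor ::
  "(complex, 'v, 'm) module_scheme \<Rightarrow> (complex, 'w, 'n) module_scheme \<Rightarrow>
    (complex, 'v \<times> 'w \<Rightarrow>\<^sub>0 complex) module" where
  "free_tensor V W \<equiv> free_space (carrier V \<times> carrier W)"

abbreviation gen :: "'v \<Rightarrow> 'w \<Rightarrow> ('v \<times> 'w \<Rightarrow>\<^sub>0 complex)" where
  "gen v w \<equiv> Poly_Mapping.single (v, w) 1"

definition bilinearity_relations ::
  "(complex, 'v, 'm) module_scheme \<Rightarrow> (complex, 'w, 'n) module_scheme \<Rightarrow>
    ('v \<times> 'w \<Rightarrow>\<^sub>0 complex) set" where
  "bilinearity_relations V W =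
    {gen (v \<oplus>\<^bsub>V\<^esub> v') w - (gen v w + gen v' w) | v v' w.
       v \<in> carrier V \<and> v' \<in> carrier V \<and> w \<in> carrier W} \<union>
    {gen v (w \<oplus>\<^bsub>W\<^esub> w') - (gen v w + gen v w') | v w w'.
       v \<in> carrier V \<and> w \<in> carrier W \<and> w' \<in> carrier W} \<union>
    {gen (c \<odot>\<^bsub>V\<^esub> v) w - Poly_Mapping.single (v, w) c | c v w.
       v \<in> carrier V \<and> w \<in> carrier W} \<union>
    {gen v (c \<odot>\<^bsub>W\<^esub> w) - Poly_Mapping.single (v, w) c | c v w.
       v \<in> carrier V \<and> w \<in> carrier W}"

definition tensor_null ::
  "(complex, 'v, 'm) module_scheme \<Rightarrow> (complex, 'w, 'n) module_scheme \<Rightarrow>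
    ('v \<times> 'w \<Rightarrow>\<^sub>0 complex) set" where
  "tensor_null V W = submodule_gen (free_tensor V W) (bilinearity_relations V W)"

definition tensor_space ::
  "(complex, 'v, 'm) module_scheme \<Rightarrow> (complex, 'w, 'n) module_scheme \<Rightarrow>
    (complex, ('v, 'w) tensor) module" where
  "tensor_space V W = quotient_space (free_tensor V W) (tensor_null V W)"

definition pure_tensor ::
  "(complex, 'v, 'm) module_scheme \<Rightarrow> (complex, 'w, 'n) module_scheme \<Rightarrow> 'v \<Rightarrow> 'w \<Rightarrow>
    ('v, 'w) tensor" where
  "pure_tensor V W v w = tensor_null V W +>\<^bsub>free_tensor V W\<^esub> gen v w"

text \<open>For bilinear \<open>\<beta>\<close> with values in \<open>U\<close>, \<open>tensor_lift U \<beta>\<close> is the linear map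
  \<open>v \<otimes> w \<mapsto> \<beta> v w\<close>: evaluation of \<open>\<beta>\<close> is constant on the cosets constituting \<open>V \<otimes> W\<close>.\<close>

definition tensor_lift ::
  "(complex, 'u, 'l) module_scheme \<Rightarrow> ('v \<Rightarrow> 'w \<Rightarrow> 'u) \<Rightarrow> ('v, 'w) tensor \<Rightarrow> 'u" where
  "tensor_lift U \<beta> t =
    the_elem ((\<lambda>x. \<Oplus>\<^bsub>U\<^esub>p\<in>Poly_Mapping.keys x.
      Poly_Mapping.lookup x p \<odot>\<^bsub>U\<^esub> \<beta> (fst p) (snd p)) ` t)"

text \<open>The linear map \<open>f \<otimes> g\<close> into \<open>V' \<otimes> W'\<close>, for linear \<open>f\<close> into \<open>V'\<close> and \<open>g\<close> into \<open>W'\<close>.\<close>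

definition tensor_map ::
  "(complex, 'v', 'm) module_scheme \<Rightarrow> (complex, 'w', 'n) module_scheme \<Rightarrow>
    ('v \<Rightarrow> 'v') \<Rightarrow> ('w \<Rightarrow> 'w') \<Rightarrow> ('v, 'w) tensor \<Rightarrow> ('v', 'w') tensor" where
  "tensor_map V' W' f g =
    tensor_lift (tensor_space V' W') (\<lambda>v w. pure_tensor V' W' (f v) (g w))"

text \<open>For antilinear \<open>f\<close> and \<open>g\<close> the map \<open>f \<otimes> g\<close> is antilinear, that is, linear into the
  conjugate of \<open>V' \<otimes> W'\<close> (in the model with unchanged carrier).\<close>

definition antilinear_tensor_map ::
  "(complex, 'v', 'm) module_scheme \<Rightarrow> (complex, 'w', 'n) module_scheme \<Rightarrow>
    ('v \<Rightarrow> 'v') \<Rightarrow> ('w \<Rightarrow> 'w') \<Rightarrow> ('v, 'w) tensor \<Rightarrow> ('v', 'w') tensor" where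
  "antilinear_tensor_map V' W' f g =
    tensor_lift (conj_space id (tensor_space V' W')) (\<lambda>v w. pure_tensor V' W' (f v) (g w))"

text \<open>The associativity isomorphism \<open>(U \<otimes> V) \<otimes> W \<rightarrow> U \<otimes> (V \<otimes> W)\<close>.\<close>

definition tensor_assoc ::
  "(complex, 'u, 'l) module_scheme \<Rightarrow> (complex, 'v, 'm) module_scheme \<Rightarrow>
    (complex, 'w, 'n) module_scheme \<Rightarrow> (('u, 'v) tensor, 'w) tensor \<Rightarrow> ('u, ('v, 'w) tensor) tensor"
  where
  "tensor_assoc U V W =
    tensor_lift (tensor_space U (tensor_space V W))
      (\<lambda>t w. tensor_lift (tensor_space U (tensor_space V W))
        (\<lambda>u v. pure_tensor U (tensor_space V W) u (pure_tensor V W v w)) t)"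

text \<open>The algebra \<open>A \<otimes> B\<close>, with product \<open>(a \<otimes> b) (a' \<otimes> b') = a a' \<otimes> b b'\<close>.\<close>

definition tensor_algebra ::
  "(complex, 'a, 'm) module_scheme \<Rightarrow> (complex, 'b, 'n) module_scheme \<Rightarrow>
    (complex, ('a, 'b) tensor) module" where
  "tensor_algebra A B = (tensor_space A B)
    \<lparr>monoid.mult := (\<lambda>s t. tensor_lift (tensor_space A B)
       (\<lambda>a b. tensor_lift (tensor_space A B)
         (\<lambda>a' b'. pure_tensor A B (a \<otimes>\<^bsub>A\<^esub> a') (b \<otimes>\<^bsub>B\<^esub> b')) t) s),
     one := pure_tensor A B \<one>\<^bsub>A\<^esub> \<one>\<^bsub>B\<^esub>\<rparr>"


section \<open>Hopf algebras and Hopf *-algebras\<close>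

record 'h hopf = "(complex, 'h) module" +
  comult :: "'h \<Rightarrow> ('h, 'h) tensor"
  counit :: "'h \<Rightarrow> complex"
  antipode :: "'h \<Rightarrow> 'h"

record 'h hopf_star = "'h hopf" +
  star :: "'h \<Rightarrow> 'h"

locale hopf_algebra = complex_algebra H for H (structure) +
  assumes comult_linear: "comult H \<in> lin_hom H (tensor_space H H)"
    and comult_mult: "\<lbrakk>a \<in> carrier H; b \<in> carrier H\<rbrakk> \<Longrightarrow>
      comult H (a \<otimes> b) = comult H a \<otimes>\<^bsub>tensor_algebra H H\<^esub> comult H b"
    and comult_one: "comult H \<one> = \<one>\<^bsub>tensor_algebra H H\<^esub>"
    and coassoc: "a \<in> carrier H \<Longrightarrow>
      tensor_assoc H H H (tensor_map (tensor_space H H) H (comult H) id (comult H a)) =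
      tensor_map H (tensor_space H H) id (comult H) (comult H a)"
    and counit_linear: "counit H \<in> lin_hom H complex_alg"
    and counit_mult: "\<lbrakk>a \<in> carrier H; b \<in> carrier H\<rbrakk> \<Longrightarrow>
      counit H (a \<otimes> b) = counit H a * counit H b"
    and counit_one: "counit H \<one> = 1"
    and counit_left: "a \<in> carrier H \<Longrightarrow>
      tensor_lift H (\<lambda>x y. counit H x \<odot> y) (comult H a) = a"
    and counit_right: "a \<in> carrier H \<Longrightarrow>
      tensor_lift H (\<lambda>x y. counit H y \<odot> x) (comult H a) = a"
    and antipode_linear: "antipode H \<in> lin_hom H H"
    and antipode_left: "a \<in> carrier H \<Longrightarrow>
      tensor_lift H (\<lambda>x y. antipode H x \<otimes> y) (comult H a) = counit H a \<odot> \<one>"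
    and antipode_right: "a \<in> carrier H \<Longrightarrow>
      tensor_lift H (\<lambda>x y. x \<otimes> antipode H y) (comult H a) = counit H a \<odot> \<one>"

locale hopf_star_algebra = hopf_algebra H for H (structure) +
  assumes star_closed: "a \<in> carrier H \<Longrightarrow> star H a \<in> carrier H"
    and star_add: "\<lbrakk>a \<in> carrier H; b \<in> carrier H\<rbrakk> \<Longrightarrow> star H (a \<oplus> b) = star H a \<oplus> star H b"
    and star_smult: "a \<in> carrier H \<Longrightarrow> star H (c \<odot> a) = cnj c \<odot> star H a"
    and star_star: "a \<in> carrier H \<Longrightarrow> star H (star H a) = a"
    and star_mult: "\<lbrakk>a \<in> carrier H; b \<in> carrier H\<rbrakk> \<Longrightarrow> star H (a \<otimes> b) = star H b \<otimes> star H a"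
    and comult_star: "a \<in> carrier H \<Longrightarrow>
      comult H (star H a) = antilinear_tensor_map H H (star H) (star H) (comult H a)"


section \<open>Left modules over a complex algebra, and their maps\<close>

record ('h, 'v) hmodule = "(complex, 'v) module" +
  act :: "'h \<Rightarrow> 'v \<Rightarrow> 'v"

locale left_hmodule = H?: complex_algebra H + V: Module.module complex_alg V
  for H (structure) and V :: "('h, 'v, 'm) hmodule_scheme" (structure) +
  assumes act_linear: "a \<in> carrier H \<Longrightarrow> act V a \<in> lin_hom V V"
    and act_add: "\<lbrakk>a \<in> carrier H; b \<in> carrier H; v \<in> carrier V\<rbrakk> \<Longrightarrow>
      act V (a \<oplus>\<^bsub>H\<^esub> b) v = act V a v \<oplus>\<^bsub>V\<^esub> act V b v"
    and act_smult: "\<lbrakk>a \<in> carrier H; v \<in> carrier V\<rbrakk> \<Longrightarrow> act V (c \<odot>\<^bsub>H\<^esub> a) v = c \<odot>\<^bsub>V\<^esub> act V a v"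
    and act_mult: "\<lbrakk>a \<in> carrier H; b \<in> carrier H; v \<in> carrier V\<rbrakk> \<Longrightarrow>
      act V (a \<otimes>\<^bsub>H\<^esub> b) v = act V a (act V b v)"
    and act_one: "v \<in> carrier V \<Longrightarrow> act V \<one>\<^bsub>H\<^esub> v = v"

text \<open>Maps are represented by extensional functions, so that equality of functions is equality
  of maps.\<close>

definition hmod_hom ::
  "(complex, 'h, 'l) module_scheme \<Rightarrow> ('h, 'v, 'm) hmodule_scheme \<Rightarrow> ('h, 'w, 'n) hmodule_scheme \<Rightarrow>
    ('v \<Rightarrow> 'w) set" where
  "hmod_hom H V W = {T \<in> lin_hom V W \<inter> extensional (carrier V).
     \<forall>a\<in>carrier H. \<forall>v\<in>carrier V. T (act V a v) = act W a (T v)}"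

definition conj_hmodule ::
  "('h, 'l) hopf_star_scheme \<Rightarrow> ('v \<Rightarrow> 'w) \<Rightarrow> ('h, 'v, 'm) hmodule_scheme \<Rightarrow> ('h, 'w) hmodule" where
  "conj_hmodule H bar V = module.extend (conj_space bar V)
     (hmodule.fields (\<lambda>a x. bar (act V (star H (antipode H a)) (the_inv bar x))))"

lemma conj_hmodule_act:
  assumes "inj bar"
  shows "act (conj_hmodule H bar V) a (bar v) = bar (act V (star H (antipode H a)) v)"
  using assms by (simp add: conj_hmodule_def hmodule.defs module.defs the_inv_f_f)

lemma conj_hmodule_truncate: "module.truncate (conj_hmodule H bar V) = conj_space bar V"
  by (simp add: conj_hmodule_def hmodule.defs module.defs the_inv_f_f)


section \<open>Categories and functors\<close>

record ('o, 'm) category =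
  Obj :: "'o set"
  Hom :: "'o \<Rightarrow> 'o \<Rightarrow> 'm set"
  Ident :: "'o \<Rightarrow> 'm"
  Comp :: "'o \<Rightarrow> 'o \<Rightarrow> 'o \<Rightarrow> 'm \<Rightarrow> 'm \<Rightarrow> 'm"

text \<open>For \<open>f \<in> Hom C X Y\<close> and \<open>g \<in> Hom C Y Z\<close>, \<open>Comp C X Y Z g f\<close> is the composite \<open>g \<circ> f\<close>.
  Hom sets of different pairs of objects need not be disjoint, therefore composition and the
  arrow part of a functor take the objects as arguments.\<close>

locale category =
  fixes C :: "('o, 'm) category"
  assumes Ident_in: "X \<in> Obj C \<Longrightarrow> Ident C X \<in> Hom C X X"
    and Comp_in: "\<lbrakk>X \<in> Obj C; Y \<in> Obj C; Z \<in> Obj C; f \<in> Hom C X Y; g \<in> Hom C Y Z\<rbrakk> \<Longrightarrow>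
      Comp C X Y Z g f \<in> Hom C X Z"
    and Comp_Ident_left: "\<lbrakk>X \<in> Obj C; Y \<in> Obj C; f \<in> Hom C X Y\<rbrakk> \<Longrightarrow>
      Comp C X Y Y (Ident C Y) f = f"
    and Comp_Ident_right: "\<lbrakk>X \<in> Obj C; Y \<in> Obj C; f \<in> Hom C X Y\<rbrakk> \<Longrightarrow>
      Comp C X X Y f (Ident C X) = f"
    and Comp_assoc: "\<lbrakk>W \<in> Obj C; X \<in> Obj C; Y \<in> Obj C; Z \<in> Obj C;
      f \<in> Hom C W X; g \<in> Hom C X Y; h \<in> Hom C Y Z\<rbrakk> \<Longrightarrow>
      Comp C W X Z (Comp C X Y Z h g) f = Comp C W Y Z h (Comp C W X Y g f)"

locale cat_functor = C: category C + D: category D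
  for C :: "('o, 'm) category" and D :: "('o', 'm') category" +
  fixes F_obj :: "'o \<Rightarrow> 'o'" and F_map :: "'o \<Rightarrow> 'o \<Rightarrow> 'm \<Rightarrow> 'm'"
  assumes F_obj_in: "X \<in> Obj C \<Longrightarrow> F_obj X \<in> Obj D"
    and F_map_in: "\<lbrakk>X \<in> Obj C; Y \<in> Obj C; f \<in> Hom C X Y\<rbrakk> \<Longrightarrow>
      F_map X Y f \<in> Hom D (F_obj X) (F_obj Y)"
    and F_Ident: "X \<in> Obj C \<Longrightarrow> F_map X X (Ident C X) = Ident D (F_obj X)"
    and F_Comp: "\<lbrakk>X \<in> Obj C; Y \<in> Obj C; Z \<in> Obj C; f \<in> Hom C X Y; g \<in> Hom C Y Z\<rbrakk> \<Longrightarrow>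
      F_map X Z (Comp C X Y Z g f) =
      Comp D (F_obj X) (F_obj Y) (F_obj Z) (F_map Y Z g) (F_map X Y f)"

abbreviation endofunctor ::
  "('o, 'm) category \<Rightarrow> ('o \<Rightarrow> 'o) \<Rightarrow> ('o \<Rightarrow> 'o \<Rightarrow> 'm \<Rightarrow> 'm) \<Rightarrow> bool" where
  "endofunctor C \<equiv> cat_functor C C"

text \<open>The category of those left \<open>H\<close>-modules whose elements belong to the type \<open>'v\<close>.\<close>

definition HMod :: "(complex, 'h, 'l) module_scheme \<Rightarrow> (('h, 'v) hmodule, 'v \<Rightarrow> 'v) category" where
  "HMod H =
    \<lparr>Obj = {V. left_hmodule H V}, Hom = hmod_hom H,
     Ident = (\<lambda>V. \<lambda>v\<in>carrier V. v),
     Comp = (\<lambda>U V W. compose (carrier U))\<rparr>"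

end

theory Submission
  imports Defs
begin

text \<open>The element \<open>a\<close> acts on the conjugate of \<open>V\<close> through \<open>\<sigma>(a) = S(a)\<^sup>*\<close>. The antilinearity of \<open>\<sigma>\<close> is
  absorbed by the conjugation of the scalars, so the only substantial point is that \<open>\<sigma>\<close> respects
  products and the unit. The star reverses products; hence everything rests on the classical fact
  that the antipode reverses products too, \<open>S(ab) = S(b) S(a)\<close>, and fixes the unit (lemmas
  \<open>antipode_mult\<close> and \<open>antipode_one\<close>). An \<open>H\<close>-linear map intertwines in particular the actions of the
  elements \<open>\<sigma>(a)\<close>, so its conjugate is \<open>H\<close>-linear, and conjugation of maps visibly preserves identities and
  composites.

  The usual proof of \<open>S(ab) = S(b) S(a)\<close> compares two convolution inverses of the multiplication
  map \<open>H \<otimes> H \<rightarrow> H\<close>. The proof below is an unfolded variant which first shows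
  \<open>b\<^sub>1 S(a b\<^sub>2) = \<epsilon>(b) S(a)\<close> and then multiplies by \<open>S(b\<^sub>1)\<close> on the left. It is carried out in a
  rendering of Sweedler notation: \<open>sweedler \<beta> a\<close> is the value of a bilinear map \<open>\<beta>\<close> on the coproduct
  of \<open>a\<close>, and the Hopf algebra axioms become rewrite rules for nested expressions of this kind
  (\<open>sweedler_coassoc\<close>, \<open>sweedler_mult\<close>).

  These rules come from the universal property of the tensor product, which has to be derived
  from the explicit construction as a quotient of a free vector space: bilinear maps lift to linear maps
  (\<open>tensor_lift_linear\<close>, \<open>tensor_lift_pure\<close>), and linear maps that agree on pure tensors are
  equal (\<open>tensor_hom_eq\<close>).\<close>

section \<open>Linear and bilinear maps\<close>

abbreviation complex_space :: "(complex, 'v, 'm) module_scheme \<Rightarrow> bool" where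
  "complex_space V \<equiv> Module.module complex_alg V"

lemma complex_alg_simps [simp]:
  "carrier complex_alg = UNIV" "x \<otimes>\<^bsub>complex_alg\<^esub> y = x * y" "\<one>\<^bsub>complex_alg\<^esub> = 1"
  "x \<oplus>\<^bsub>complex_alg\<^esub> y = x + y" "\<zero>\<^bsub>complex_alg\<^esub> = 0" "c \<odot>\<^bsub>complex_alg\<^esub> x = c * x"
  by (simp_all add: complex_alg_def)

lemma complex_spaceI:
  fixes V (structure)
  assumes "abelian_group V"
    and "\<And>c x. x \<in> carrier V \<Longrightarrow> c \<odot> x \<in> carrier V"
    and "\<And>c d x. x \<in> carrier V \<Longrightarrow> (c + d) \<odot> x = c \<odot> x \<oplus> d \<odot> x"
    and "\<And>c x y. \<lbrakk>x \<in> carrier V; y \<in> carrier V\<rbrakk> \<Longrightarrow> c \<odot> (x \<oplus> y) = c \<odot> x \<oplus> c \<odot> y"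
    and "\<And>c d x. x \<in> carrier V \<Longrightarrow> (c * d) \<odot> x = c \<odot> (d \<odot> x)"
    and "\<And>x. x \<in> carrier V \<Longrightarrow> 1 \<odot> x = x"
  shows "complex_space V"
  using assms fieldE(1)[OF field_complex_alg] by (intro moduleI) simp_all

lemma complex_space_simps:
  fixes V (structure)
  assumes "complex_space V"
  shows "x \<in> carrier V \<Longrightarrow> c \<odot> x \<in> carrier V"
    and "x \<in> carrier V \<Longrightarrow> (c + d) \<odot> x = c \<odot> x \<oplus> d \<odot> x"
    and "\<lbrakk>x \<in> carrier V; y \<in> carrier V\<rbrakk> \<Longrightarrow> c \<odot> (x \<oplus> y) = c \<odot> x \<oplus> c \<odot> y"
    and "x \<in> carrier V \<Longrightarrow> (c * d) \<odot> x = c \<odot> (d \<odot> x)"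
    and "x \<in> carrier V \<Longrightarrow> 1 \<odot> x = x"
    and "x \<in> carrier V \<Longrightarrow> 0 \<odot> x = \<zero>"
    and "c \<odot> \<zero> = \<zero>"
    and "\<zero> \<in> carrier V"
    and "\<lbrakk>x \<in> carrier V; y \<in> carrier V\<rbrakk> \<Longrightarrow> x \<oplus> y \<in> carrier V"
    and "abelian_group V"
proof -
  interpret Module.module complex_alg V by fact
  show "x \<in> carrier V \<Longrightarrow> c \<odot> x \<in> carrier V"
    and "x \<in> carrier V \<Longrightarrow> (c + d) \<odot> x = c \<odot> x \<oplus> d \<odot> x"
    and "\<lbrakk>x \<in> carrier V; y \<in> carrier V\<rbrakk> \<Longrightarrow> c \<odot> (x \<oplus> y) = c \<odot> x \<oplus> c \<odot> y"
    and "x \<in> carrier V \<Longrightarrow> (c * d) \<odot> x = c \<odot> (d \<odot> x)"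
    and "x \<in> carrier V \<Longrightarrow> 1 \<odot> x = x"
    and "x \<in> carrier V \<Longrightarrow> 0 \<odot> x = \<zero>"
    and "c \<odot> \<zero> = \<zero>"
    and "\<zero> \<in> carrier V"
    and "\<lbrakk>x \<in> carrier V; y \<in> carrier V\<rbrakk> \<Longrightarrow> x \<oplus> y \<in> carrier V"
    using smult_closed[of c x] smult_l_distr[of c d x] smult_r_distr[of c x y]
      smult_assoc1[of c d x] smult_one[of x] smult_l_null[of x] smult_r_null[of c]
    by simp_all
  show "abelian_group V" ..
qed

lemma lin_homI:
  assumes "\<And>x. x \<in> carrier V \<Longrightarrow> f x \<in> carrier W"
    and "\<And>x y. \<lbrakk>x \<in> carrier V; y \<in> carrier V\<rbrakk> \<Longrightarrow> f (x \<oplus>\<^bsub>V\<^esub> y) = f x \<oplus>\<^bsub>W\<^esub> f y"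
    and "\<And>c x. x \<in> carrier V \<Longrightarrow> f (c \<odot>\<^bsub>V\<^esub> x) = c \<odot>\<^bsub>W\<^esub> f x"
  shows "f \<in> lin_hom V W"
  using assms by (simp add: lin_hom_def)

lemma lin_homD:
  assumes "f \<in> lin_hom V W"
  shows "x \<in> carrier V \<Longrightarrow> f x \<in> carrier W"
    and "\<lbrakk>x \<in> carrier V; y \<in> carrier V\<rbrakk> \<Longrightarrow> f (x \<oplus>\<^bsub>V\<^esub> y) = f x \<oplus>\<^bsub>W\<^esub> f y"
    and "x \<in> carrier V \<Longrightarrow> f (c \<odot>\<^bsub>V\<^esub> x) = c \<odot>\<^bsub>W\<^esub> f x"
  using assms by (auto simp: lin_hom_def)

lemma lin_hom_zero:
  assumes "complex_space V" "complex_space W" "f \<in> lin_hom V W"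
  shows "f \<zero>\<^bsub>V\<^esub> = \<zero>\<^bsub>W\<^esub>"
  using lin_homD(3)[OF assms(3), of "\<zero>\<^bsub>V\<^esub>" 0] lin_homD(1)[OF assms(3), of "\<zero>\<^bsub>V\<^esub>"]
    complex_space_simps(6-8)[OF assms(1)] complex_space_simps(6)[OF assms(2)]
  by simp

lemma lin_hom_ident: "(\<lambda>x. x) \<in> lin_hom V V"
  by (simp add: lin_hom_def)

lemma lin_hom_comp:
  assumes "g \<in> lin_hom V W" "f \<in> lin_hom U V"
  shows "(\<lambda>x. g (f x)) \<in> lin_hom U W"
  using assms by (auto simp: lin_hom_def Pi_iff)

lemma lin_hom_plus:
  assumes "complex_space W" "f \<in> lin_hom V W" "g \<in> lin_hom V W"
  shows "(\<lambda>x. f x \<oplus>\<^bsub>W\<^esub> g x) \<in> lin_hom V W"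
proof (rule lin_homI)
  interpret W: abelian_group W using complex_space_simps(10)[OF assms(1)] .
  note f = lin_homD[OF assms(2)] and g = lin_homD[OF assms(3)]
  show "f x \<oplus>\<^bsub>W\<^esub> g x \<in> carrier W" if "x \<in> carrier V" for x
    using that f(1) g(1) by simp
  show "f (x \<oplus>\<^bsub>V\<^esub> y) \<oplus>\<^bsub>W\<^esub> g (x \<oplus>\<^bsub>V\<^esub> y) = (f x \<oplus>\<^bsub>W\<^esub> g x) \<oplus>\<^bsub>W\<^esub> (f y \<oplus>\<^bsub>W\<^esub> g y)"
    if "x \<in> carrier V" "y \<in> carrier V" for x y
    using that f g by (simp add: W.a_ac)
  show "f (c \<odot>\<^bsub>V\<^esub> x) \<oplus>\<^bsub>W\<^esub> g (c \<odot>\<^bsub>V\<^esub> x) = c \<odot>\<^bsub>W\<^esub> (f x \<oplus>\<^bsub>W\<^esub> g x)"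
    if "x \<in> carrier V" for c x
    using that f g by (simp add: complex_space_simps[OF assms(1)])
qed

lemma lin_hom_scale:
  assumes "complex_space W" "f \<in> lin_hom V W"
  shows "(\<lambda>x. c \<odot>\<^bsub>W\<^esub> f x) \<in> lin_hom V W"
  using lin_homD[OF assms(2)]
  by (intro lin_homI)
    (simp_all add: complex_space_simps[OF assms(1)] mult.commute
      flip: complex_space_simps(4)[OF assms(1)])

definition bilin_hom ::
  "(complex, 'v, 'm) module_scheme \<Rightarrow> (complex, 'w, 'n) module_scheme \<Rightarrow>
    (complex, 'u, 'l) module_scheme \<Rightarrow> ('v \<Rightarrow> 'w \<Rightarrow> 'u) set" where
  "bilin_hom V W U = {\<beta>. (\<forall>v\<in>carrier V. (\<lambda>w. \<beta> v w) \<in> lin_hom W U) \<and>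
     (\<forall>w\<in>carrier W. (\<lambda>v. \<beta> v w) \<in> lin_hom V U)}"

lemma bilin_homI:
  assumes "\<And>v. v \<in> carrier V \<Longrightarrow> (\<lambda>w. \<beta> v w) \<in> lin_hom W U"
    and "\<And>w. w \<in> carrier W \<Longrightarrow> (\<lambda>v. \<beta> v w) \<in> lin_hom V U"
  shows "\<beta> \<in> bilin_hom V W U"
  using assms by (simp add: bilin_hom_def)

lemma bilin_homD:
  assumes "\<beta> \<in> bilin_hom V W U"
  shows "v \<in> carrier V \<Longrightarrow> (\<lambda>w. \<beta> v w) \<in> lin_hom W U"
    and "w \<in> carrier W \<Longrightarrow> (\<lambda>v. \<beta> v w) \<in> lin_hom V U"
    and "\<lbrakk>v \<in> carrier V; w \<in> carrier W\<rbrakk> \<Longrightarrow> \<beta> v w \<in> carrier U"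
  using assms lin_homD(1)[of "\<beta> v" W U] by (auto simp: bilin_hom_def)

lemma bilin_hom_comp:
  assumes "f \<in> lin_hom U U'" "\<beta> \<in> bilin_hom V W U"
  shows "(\<lambda>v w. f (\<beta> v w)) \<in> bilin_hom V W U'"
  using assms by (auto simp: bilin_hom_def intro: lin_hom_comp)

section \<open>Free vector spaces and quotients\<close>

lemma lookup_scale [simp]:
  "Poly_Mapping.lookup (Poly_Mapping.map ((*) c) x) p = (c :: complex) * Poly_Mapping.lookup x p"
  by (simp add: Poly_Mapping.map.rep_eq when_def)

lemma keys_scale: "Poly_Mapping.keys (Poly_Mapping.map ((*) (c :: complex)) x) \<subseteq> Poly_Mapping.keys x"
  by (auto simp: in_keys_iff)

lemma free_space_simps [simp]:
  "carrier (free_space X) = {f. Poly_Mapping.keys f \<subseteq> X}"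
  "x \<oplus>\<^bsub>free_space X\<^esub> y = x + y" "\<zero>\<^bsub>free_space X\<^esub> = 0"
  "c \<odot>\<^bsub>free_space X\<^esub> x = Poly_Mapping.map ((*) c) x"
  by (simp_all add: free_space_def)

lemma complex_space_free: "complex_space (free_space X)"
proof (rule complex_spaceI)
  show "abelian_group (free_space X)"
  proof (rule abelian_groupI)
    fix x assume "x \<in> carrier (free_space X)"
    then show "\<exists>y\<in>carrier (free_space X). y \<oplus>\<^bsub>free_space X\<^esub> x = \<zero>\<^bsub>free_space X\<^esub>"
      by (intro bexI[of _ "- x"]) simp_all
  qed (auto simp: add_ac dest: subsetD[OF Poly_Mapping.keys_add])
  show "c \<odot>\<^bsub>free_space X\<^esub> x \<in> carrier (free_space X)" if "x \<in> carrier (free_space X)" for c x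
    using that keys_scale[of c x] by auto
qed (auto simp: lookup_add algebra_simps intro!: poly_mapping_eqI)

text \<open>The linear extension of a map \<open>b\<close> given on the basis; \<^const>\<open>tensor_lift\<close> evaluates representatives
  by this formula.\<close>

definition lin_ext ::
  "(complex, 'u, 'l) module_scheme \<Rightarrow> ('x \<Rightarrow> 'u) \<Rightarrow> ('x \<Rightarrow>\<^sub>0 complex) \<Rightarrow> 'u" where
  "lin_ext U b x = (\<Oplus>\<^bsub>U\<^esub>p\<in>Poly_Mapping.keys x. Poly_Mapping.lookup x p \<odot>\<^bsub>U\<^esub> b p)"

text \<open>Two sums with different supports can be added only after extending them to a common index set.\<close>

lemma lin_ext_superset:
  assumes U: "complex_space U" and b: "b \<in> A \<rightarrow> carrier U"
    and A: "finite A" "Poly_Mapping.keys x \<subseteq> A"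
  shows "lin_ext U b x = (\<Oplus>\<^bsub>U\<^esub>p\<in>A. Poly_Mapping.lookup x p \<odot>\<^bsub>U\<^esub> b p)"
proof -
  interpret U: abelian_group U using complex_space_simps(10)[OF U] .
  show ?thesis unfolding lin_ext_def
    by (rule U.add.finprod_mono_neutral_cong)
      (use assms in \<open>auto simp: complex_space_simps[OF U] not_in_keys_iff_lookup_eq_zero Pi_iff\<close>)
qed

lemma lin_ext_linear:
  assumes U: "complex_space U" and b: "b \<in> X \<rightarrow> carrier U"
  shows "lin_ext U b \<in> lin_hom (free_space X) U"
proof (rule lin_homI)
  interpret U: Module.module complex_alg U by fact
  note U' = complex_space_simps[OF U]
  show "lin_ext U b x \<in> carrier U" if "x \<in> carrier (free_space X)" for x
    unfolding lin_ext_def using that b by (intro U.finsum_closed) (auto simp: U' Pi_iff subset_iff)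
  show "lin_ext U b (x \<oplus>\<^bsub>free_space X\<^esub> y) = lin_ext U b x \<oplus>\<^bsub>U\<^esub> lin_ext U b y"
    if x: "x \<in> carrier (free_space X)" and y: "y \<in> carrier (free_space X)" for x y
  proof -
    let ?A = "Poly_Mapping.keys x \<union> Poly_Mapping.keys y"
    have A: "b \<in> ?A \<rightarrow> carrier U" "finite ?A"
      using x y b by auto
    have "lin_ext U b (x + y) = (\<Oplus>\<^bsub>U\<^esub>p\<in>?A. Poly_Mapping.lookup (x + y) p \<odot>\<^bsub>U\<^esub> b p)"
      by (rule lin_ext_superset[OF U A Poly_Mapping.keys_add])
    also have "\<dots> = (\<Oplus>\<^bsub>U\<^esub>p\<in>?A. Poly_Mapping.lookup x p \<odot>\<^bsub>U\<^esub> b p \<oplus>\<^bsub>U\<^esub> Poly_Mapping.lookup y p \<odot>\<^bsub>U\<^esub> b p)"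
      using A by (intro U.finsum_cong') (auto simp: U' lookup_add Pi_iff)
    also have "\<dots> = (\<Oplus>\<^bsub>U\<^esub>p\<in>?A. Poly_Mapping.lookup x p \<odot>\<^bsub>U\<^esub> b p) \<oplus>\<^bsub>U\<^esub>
        (\<Oplus>\<^bsub>U\<^esub>p\<in>?A. Poly_Mapping.lookup y p \<odot>\<^bsub>U\<^esub> b p)"
      using A by (intro U.finsum_addf) (auto simp: U' Pi_iff)
    also have "\<dots> = lin_ext U b x \<oplus>\<^bsub>U\<^esub> lin_ext U b y"
      using lin_ext_superset[OF U A, of x] lin_ext_superset[OF U A, of y] by simp
    finally show ?thesis by simp
  qed
  show "lin_ext U b (c \<odot>\<^bsub>free_space X\<^esub> x) = c \<odot>\<^bsub>U\<^esub> lin_ext U b x"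
    if x: "x \<in> carrier (free_space X)" for c x
  proof -
    let ?A = "Poly_Mapping.keys x"
    have A: "b \<in> ?A \<rightarrow> carrier U" "finite ?A"
      using x b by auto
    have "lin_ext U b (c \<odot>\<^bsub>free_space X\<^esub> x) = (\<Oplus>\<^bsub>U\<^esub>p\<in>?A. (c * Poly_Mapping.lookup x p) \<odot>\<^bsub>U\<^esub> b p)"
      using lin_ext_superset[OF U A keys_scale] by simp
    also have "\<dots> = (\<Oplus>\<^bsub>U\<^esub>p\<in>?A. c \<odot>\<^bsub>U\<^esub> (Poly_Mapping.lookup x p \<odot>\<^bsub>U\<^esub> b p))"
      using A by (intro U.finsum_cong') (auto simp: U' Pi_iff)
    also have "\<dots> = c \<odot>\<^bsub>U\<^esub> lin_ext U b x"
      unfolding lin_ext_def using A by (intro U.finsum_smult_ldistr[symmetric]) (auto simp: U' Pi_iff)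
    finally show ?thesis .
  qed
qed

lemma lin_ext_single:
  assumes "complex_space U" "b p \<in> carrier U"
  shows "lin_ext U b (Poly_Mapping.single p c) = c \<odot>\<^bsub>U\<^esub> b p"
proof -
  interpret U: abelian_group U using complex_space_simps(10)[OF assms(1)] .
  have "lin_ext U b (Poly_Mapping.single p c) = (\<Oplus>\<^bsub>U\<^esub>q\<in>{p}. Poly_Mapping.lookup (Poly_Mapping.single p c) q \<odot>\<^bsub>U\<^esub> b q)"
    using assms by (intro lin_ext_superset) auto
  then show ?thesis
    using assms by (simp add: complex_space_simps)
qed

text \<open>A vector with finite support is built from 0 by adding one multiple of a basis vector at a time,
  hence linear maps agree as soon as they agree on the basis.\<close>

lemma free_space_hom_eq:
  assumes U: "complex_space U"
    and f: "f \<in> lin_hom (free_space X) U" and g: "g \<in> lin_hom (free_space X) U"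
    and eq: "\<And>p. p \<in> X \<Longrightarrow> f (Poly_Mapping.single p 1) = g (Poly_Mapping.single p 1)"
    and x: "Poly_Mapping.keys x \<subseteq> X"
  shows "f x = g x"
  using x
proof (induction x rule: update_induct)
  case const
  then show ?case
    using lin_hom_zero[OF complex_space_free U f] lin_hom_zero[OF complex_space_free U g] by simp
next
  case (update x p c)
  have p: "p \<in> X" and x: "Poly_Mapping.keys x \<subseteq> X"
    using update by (auto simp: keys_update split: if_splits)
  have eqp: "Poly_Mapping.update p c x = x + Poly_Mapping.map ((*) c) (Poly_Mapping.single p 1)"
    using update(1) by (intro poly_mapping_eqI)
      (auto simp: lookup_update lookup_add lookup_single in_keys_iff when_def)
  have "h (Poly_Mapping.update p c x) = h x \<oplus>\<^bsub>U\<^esub> c \<odot>\<^bsub>U\<^esub> h (Poly_Mapping.single p 1)"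
    if h: "h \<in> lin_hom (free_space X) U" for h
    unfolding eqp using lin_homD(2)[OF h, of x "Poly_Mapping.map ((*) c) (Poly_Mapping.single p 1)"]
      lin_homD(3)[OF h, of "Poly_Mapping.single p 1" c] x p keys_scale[of c "Poly_Mapping.single p 1"]
    by (auto simp del: map_single)
  then show ?case
    using f g eq[OF p] update.IH[OF x] by metis
qed

lemma submodule_submodule_gen:
  assumes V: "complex_space V" and R: "R \<subseteq> carrier V"
  shows "submodule (submodule_gen V R) complex_alg V"
proof -
  interpret V: Module.module complex_alg V by fact
  show ?thesis
    unfolding submodule_gen_def
  proof (rule V.submoduleI)
    let ?I = "\<Inter> {N. submodule N complex_alg V \<and> R \<subseteq> N}"
    show "?I \<subseteq> carrier V"
      using V.carrier_is_submodule R by blast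
    show "\<zero>\<^bsub>V\<^esub> \<in> ?I"
      using subgroup.one_closed[OF submodule.axioms(1)] by fastforce
    show "\<ominus>\<^bsub>V\<^esub> x \<in> ?I" if "x \<in> ?I" for x
      using that V.submoduleE(3)[of _ x] by blast
    show "x \<oplus>\<^bsub>V\<^esub> y \<in> ?I" if "x \<in> ?I" "y \<in> ?I" for x y
      using that V.submoduleE(5)[of _ x y] by blast
    show "c \<odot>\<^bsub>V\<^esub> x \<in> ?I" if "c \<in> carrier complex_alg" "x \<in> ?I" for c x
      using that V.submoduleE(4)[of _ c x] by blast
  qed
qed

lemma kernel_submodule:
  assumes V: "complex_space V" and U: "complex_space U" and f: "f \<in> lin_hom V U"
  shows "submodule {x \<in> carrier V. f x = \<zero>\<^bsub>U\<^esub>} complex_alg V"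
proof -
  interpret V: Module.module complex_alg V by fact
  interpret U: Module.module complex_alg U by fact
  note f = lin_homD[OF f] lin_hom_zero[OF V U f]
  have "f (\<ominus>\<^bsub>V\<^esub> x) = \<zero>\<^bsub>U\<^esub>" if "x \<in> carrier V" "f x = \<zero>\<^bsub>U\<^esub>" for x
    using f(2)[of x "\<ominus>\<^bsub>V\<^esub> x"] f(1)[of "\<ominus>\<^bsub>V\<^esub> x"] f(4) that by (simp add: V.r_neg)
  then show ?thesis
    by (intro V.submoduleI) (use f complex_space_simps[OF V] complex_space_simps[OF U] in auto)
qed

text \<open>The generated subspace is the least one containing the generators, and the kernel of \<open>f\<close> is one
  of its competitors. This makes a map defined on a free space descend to the quotient by relations.\<close>

lemma submodule_gen_kernel:
  assumes V: "complex_space V" and U: "complex_space U" and f: "f \<in> lin_hom V U"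
    and R: "R \<subseteq> carrier V" "\<And>r. r \<in> R \<Longrightarrow> f r = \<zero>\<^bsub>U\<^esub>"
    and x: "x \<in> submodule_gen V R"
  shows "f x = \<zero>\<^bsub>U\<^esub>"
  using kernel_submodule[OF V U f] R x by (auto simp: submodule_gen_def)

text \<open>The union that defines scalar multiplication on cosets is a union of copies of one coset, because
  scaling maps \<open>N\<close> into itself.\<close>

lemma quotient_space_simps:
  fixes V (structure)
  assumes V: "complex_space V" and N: "submodule N complex_alg V"
  shows "carrier (quotient_space V N) = (\<lambda>x. N +> x) ` carrier V"
    and "\<lbrakk>x \<in> carrier V; y \<in> carrier V\<rbrakk> \<Longrightarrow>
      (N +> x) \<oplus>\<^bsub>quotient_space V N\<^esub> (N +> y) = N +> (x \<oplus> y)"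
    and "\<zero>\<^bsub>quotient_space V N\<^esub> = N +> \<zero>"
    and "x \<in> carrier V \<Longrightarrow> c \<odot>\<^bsub>quotient_space V N\<^esub> (N +> x) = N +> (c \<odot> x)"
    and "complex_space (quotient_space V N)"
    and "\<lbrakk>x \<in> N; y \<in> carrier V\<rbrakk> \<Longrightarrow> N +> (x \<oplus> y) = N +> y"
proof -
  interpret V: Module.module complex_alg V by fact
  interpret N: abelian_subgroup N V
    by (intro abelian_subgroupI3 additive_subgroupI submodule.axioms(1)[OF N] 
      complex_space_simps(10)[OF V])
  show car: "carrier (quotient_space V N) = (\<lambda>x. N +> x) ` carrier V"
    by (auto simp: quotient_space_def A_RCOSETS_def')
  show add: "(N +> x) \<oplus>\<^bsub>quotient_space V N\<^esub> (N +> y) = N +> (x \<oplus> y)"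
    if "x \<in> carrier V" "y \<in> carrier V" for x y
    using N.a_rcos_sum that by (simp add: quotient_space_def)
  show zero: "\<zero>\<^bsub>quotient_space V N\<^esub> = N +> \<zero>"
    using N.a_subset by (simp add: quotient_space_def)
  show absorb: "N +> (x \<oplus> y) = N +> y" if "x \<in> N" "y \<in> carrier V" for x y
    using N.a_rcos_const[OF that(1)] V.a_coset_add_assoc[OF N.a_subset, of x y] that by simp
  show smult: "c \<odot>\<^bsub>quotient_space V N\<^esub> (N +> x) = N +> (c \<odot> x)" if x: "x \<in> carrier V" for c x
  proof -
    have "N +> (c \<odot> y) = N +> (c \<odot> x)" if y: "y \<in> N +> x" for y
    proof -
      obtain n where n: "n \<in> N" "y = n \<oplus> x"
        using y unfolding a_r_coset_def' by blast
      then have "c \<odot> y = c \<odot> n \<oplus> c \<odot> x"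
        using x by (simp add: V.smult_r_distr)
      then show ?thesis
        using absorb[OF submodule.smult_closed[OF N, of c n], of "c \<odot> x"] n(1) x V.smult_closed[of c x]
        by simp
    qed
    moreover have "x \<in> N +> x"
      using x by (rule N.a_rcos_self)
    ultimately have "(\<Union>y\<in>N +> x. N +> (c \<odot> y)) = N +> (c \<odot> x)"
      by blast
    then show ?thesis
      by (simp add: quotient_space_def)
  qed
  show "complex_space (quotient_space V N)"
  proof (rule complex_spaceI)
    show "abelian_group (quotient_space V N)"
    proof (rule abelian_groupI)
      fix X assume "X \<in> carrier (quotient_space V N)"
      then obtain x where x: "x \<in> carrier V" "X = N +> x"
        by (auto simp: car)
      then show "\<exists>Y\<in>carrier (quotient_space V N). Y \<oplus>\<^bsub>quotient_space V N\<^esub> X = \<zero>\<^bsub>quotient_space V N\<^esub>"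
        by (intro bexI[of _ "N +> (\<ominus> x)"]) (auto simp: car add zero V.l_neg)
    qed (auto simp: car add zero V.a_ac)
  qed (auto simp: car add smult V.smult_r_distr complex_space_simps[OF V])
qed

section \<open>The universal property of the tensor product\<close>

lemma free_space_closed:
  shows "\<lbrakk>x \<in> carrier (free_space X); y \<in> carrier (free_space X)\<rbrakk> \<Longrightarrow> x + y \<in> carrier (free_space X)"
    and "\<lbrakk>x \<in> carrier (free_space X); y \<in> carrier (free_space X)\<rbrakk> \<Longrightarrow> x - y \<in> carrier (free_space X)"
    and "p \<in> X \<Longrightarrow> Poly_Mapping.single p c \<in> carrier (free_space X)"
  using Poly_Mapping.keys_add[of x y] keys_diff[of x y] by auto

lemma bilinearity_relations_subset:
  assumes "complex_space V" "complex_space W"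
  shows "bilinearity_relations V W \<subseteq> carrier (free_tensor V W)"
  unfolding bilinearity_relations_def
  using complex_space_simps[OF assms(1)] complex_space_simps[OF assms(2)]
  by (auto simp del: free_space_simps(1) intro!: free_space_closed)

lemma submodule_tensor_null:
  assumes "complex_space V" "complex_space W"
  shows "submodule (tensor_null V W) complex_alg (free_tensor V W)"
  unfolding tensor_null_def
  using submodule_submodule_gen[OF complex_space_free bilinearity_relations_subset[OF assms]] .

lemma complex_space_tensor:
  assumes "complex_space V" "complex_space W"
  shows "complex_space (tensor_space V W)"
  unfolding tensor_space_def
  by (rule quotient_space_simps(5)[OF complex_space_free submodule_tensor_null[OF assms]])

lemma carrier_tensor_space:
  assumes "complex_space V" "complex_space W"
  shows "carrier (tensor_space V W) =
    (\<lambda>x. tensor_null V W +>\<^bsub>free_tensor V W\<^esub> x) ` carrier (free_tensor V W)"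
  unfolding tensor_space_def
  by (rule quotient_space_simps(1)[OF complex_space_free submodule_tensor_null[OF assms]])

lemma tensor_coset_linear:
  assumes "complex_space V" "complex_space W"
  shows "(\<lambda>x. tensor_null V W +>\<^bsub>free_tensor V W\<^esub> x) \<in> lin_hom (free_tensor V W) (tensor_space V W)"
  unfolding tensor_space_def
  using quotient_space_simps[OF complex_space_free submodule_tensor_null[OF assms]]
  by (intro lin_homI) auto

text \<open>Each bilinearity relation has the form \<open>x - y\<close>; in the quotient it becomes the equation of the
  classes of \<open>x\<close> and \<open>y\<close>.\<close>

lemma tensor_coset_eqI:
  assumes "complex_space V" "complex_space W"
    and "x - y \<in> bilinearity_relations V W" "y \<in> carrier (free_tensor V W)"
  shows "tensor_null V W +>\<^bsub>free_tensor V W\<^esub> x = tensor_null V W +>\<^bsub>free_tensor V W\<^esub> y"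
proof -
  have "x - y \<in> tensor_null V W"
    using assms(3) by (auto simp: tensor_null_def submodule_gen_def)
  then have "tensor_null V W +>\<^bsub>free_tensor V W\<^esub> ((x - y) \<oplus>\<^bsub>free_tensor V W\<^esub> y) =
      tensor_null V W +>\<^bsub>free_tensor V W\<^esub> y"
    by (rule quotient_space_simps(6)[OF complex_space_free submodule_tensor_null[OF assms(1,2)] _ assms(4)])
  then show ?thesis
    by simp
qed

lemma pure_tensor_bilinear:
  fixes V :: "(complex, 'v, 'm) module_scheme" and W :: "(complex, 'w, 'n) module_scheme"
  assumes V: "complex_space V" and W: "complex_space W"
  shows "pure_tensor V W \<in> bilin_hom V W (tensor_space V W)"
proof -
  note eqI = tensor_coset_eqI[OF V W] and q = lin_homD[OF tensor_coset_linear[OF V W]]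
  note closed_F = free_space_closed(1,2) free_space_closed(3)[OF SigmaI]
  have closed: "pure_tensor V W v w \<in> carrier (tensor_space V W)"
    if "v \<in> carrier V" "w \<in> carrier W" for v w
    unfolding pure_tensor_def using q(1)[OF closed_F(3)[OF that]] .
  have add: "tensor_null V W +>\<^bsub>free_tensor V W\<^esub> (gen v w + gen v' w') =
      pure_tensor V W v w \<oplus>\<^bsub>tensor_space V W\<^esub> pure_tensor V W v' w'"
    if "v \<in> carrier V" "w \<in> carrier W" "v' \<in> carrier V" "w' \<in> carrier W" for v w v' w'
    using that q(2)[of "gen v w" "gen v' w'"] by (simp add: pure_tensor_def)
  have scale: "tensor_null V W +>\<^bsub>free_tensor V W\<^esub> Poly_Mapping.single (v, w) c =
      c \<odot>\<^bsub>tensor_space V W\<^esub> pure_tensor V W v w"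
    if "v \<in> carrier V" "w \<in> carrier W" for v w c
    using that q(3)[of "gen v w" c] by (simp add: pure_tensor_def)
  show ?thesis
  proof (intro bilin_homI lin_homI)
    fix v w w' assume *: "v \<in> carrier V" "w \<in> carrier W" "w' \<in> carrier W"
    then have "gen v (w \<oplus>\<^bsub>W\<^esub> w') - (gen v w + gen v w') \<in> bilinearity_relations V W"
      unfolding bilinearity_relations_def by blast
    from eqI[OF this closed_F(1)[OF closed_F(3) closed_F(3)]] show "pure_tensor V W v (w \<oplus>\<^bsub>W\<^esub> w') =
        pure_tensor V W v w \<oplus>\<^bsub>tensor_space V W\<^esub> pure_tensor V W v w'"
      using * add[of v w v w'] by (simp add: pure_tensor_def)
  next
    fix w v v' assume *: "w \<in> carrier W" "v \<in> carrier V" "v' \<in> carrier V"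
    then have "gen (v \<oplus>\<^bsub>V\<^esub> v') w - (gen v w + gen v' w) \<in> bilinearity_relations V W"
      unfolding bilinearity_relations_def by blast
    from eqI[OF this closed_F(1)[OF closed_F(3) closed_F(3)]] show "pure_tensor V W (v \<oplus>\<^bsub>V\<^esub> v') w =
        pure_tensor V W v w \<oplus>\<^bsub>tensor_space V W\<^esub> pure_tensor V W v' w"
      using * add[of v w v' w] by (simp add: pure_tensor_def)
  next
    fix v c w assume *: "v \<in> carrier V" "w \<in> carrier W"
    then have "gen v (c \<odot>\<^bsub>W\<^esub> w) - Poly_Mapping.single (v, w) c \<in> bilinearity_relations V W"
      unfolding bilinearity_relations_def by blast
    from eqI[OF this closed_F(3)] show "pure_tensor V W v (c \<odot>\<^bsub>W\<^esub> w) = c \<odot>\<^bsub>tensor_space V W\<^esub> pure_tensor V W v w"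
      using * scale[of v w c] by (simp add: pure_tensor_def)
  next
    fix w c v assume *: "w \<in> carrier W" "v \<in> carrier V"
    then have "gen (c \<odot>\<^bsub>V\<^esub> v) w - Poly_Mapping.single (v, w) c \<in> bilinearity_relations V W"
      unfolding bilinearity_relations_def by blast
    from eqI[OF this closed_F(3)] show "pure_tensor V W (c \<odot>\<^bsub>V\<^esub> v) w = c \<odot>\<^bsub>tensor_space V W\<^esub> pure_tensor V W v w"
      using * scale[of v w c] by (simp add: pure_tensor_def)
  qed (use closed in auto)
qed

lemmas pure_tensor_closed = bilin_homD(3)[OF pure_tensor_bilinear]

lemma lin_hom_free_diff:
  assumes U: "complex_space U" and f: "f \<in> lin_hom (free_space X) U"
    and x: "x \<in> carrier (free_space X)" and y: "y \<in> carrier (free_space X)" and eq: "f x = f y"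
  shows "f (x - y) = \<zero>\<^bsub>U\<^esub>"
proof -
  interpret U: abelian_group U using complex_space_simps(10)[OF U] .
  have "x - y \<in> carrier (free_space X)"
    using x y by (rule free_space_closed)
  then show ?thesis
    using lin_homD(1)[OF f, of "x - y"] lin_homD(1)[OF f x] lin_homD(2)[OF f, of "x - y" y] y eq
    by simp
qed

text \<open>Bilinearity of \<open>\<beta>\<close> says precisely that its linear extension takes equal values on the two sides of
  each of the four kinds of relations.\<close>

lemma lin_ext_bilinearity_relations:
  assumes V: "complex_space V" and W: "complex_space W" and U: "complex_space U"
    and \<beta>: "\<beta> \<in> bilin_hom V W U" and r: "r \<in> bilinearity_relations V W"
  shows "lin_ext U (\<lambda>p. \<beta> (fst p) (snd p)) r = \<zero>\<^bsub>U\<^esub>"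
proof -
  let ?L = "lin_ext U (\<lambda>p. \<beta> (fst p) (snd p))"
  have L: "?L \<in> lin_hom (free_tensor V W) U"
    using bilin_homD(3)[OF \<beta>] by (intro lin_ext_linear[OF U]) auto
  note b = bilin_homD(3)[OF \<beta>] lin_homD[OF bilin_homD(1)[OF \<beta>]] lin_homD[OF bilin_homD(2)[OF \<beta>]]
  note simps = complex_space_simps[OF V] complex_space_simps[OF W]
  have single: "?L (Poly_Mapping.single (v, w) c) = c \<odot>\<^bsub>U\<^esub> \<beta> v w"
    if "v \<in> carrier V" "w \<in> carrier W" for v w c
    using that b(1) by (subst lin_ext_single[OF U]) simp_all
  have add: "?L (gen v w + gen v' w') = \<beta> v w \<oplus>\<^bsub>U\<^esub> \<beta> v' w'"
    if "v \<in> carrier V" "w \<in> carrier W" "v' \<in> carrier V" "w' \<in> carrier W" for v w v' w'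
    using that lin_homD(2)[OF L, of "gen v w" "gen v' w'"] single[of v w 1] single[of v' w' 1] b(1)
    by (simp add: complex_space_simps[OF U])
  note diff = lin_hom_free_diff[OF U L] and closed_F = free_space_closed(1) free_space_closed(3)[OF SigmaI]
  show ?thesis
    using r unfolding bilinearity_relations_def Un_iff mem_Collect_eq
  proof (elim disjE exE conjE; hypsubst)
    fix v v' w assume "v \<in> carrier V" "v' \<in> carrier V" "w \<in> carrier W"
    then show "?L (gen (v \<oplus>\<^bsub>V\<^esub> v') w - (gen v w + gen v' w)) = \<zero>\<^bsub>U\<^esub>"
      by (intro diff closed_F) (simp_all add: add single b simps complex_space_simps[OF U])
  next
    fix v w w' assume "v \<in> carrier V" "w \<in> carrier W" "w' \<in> carrier W"
    then show "?L (gen v (w \<oplus>\<^bsub>W\<^esub> w') - (gen v w + gen v w')) = \<zero>\<^bsub>U\<^esub>"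
      by (intro diff closed_F) (simp_all add: add single b simps complex_space_simps[OF U])
  next
    fix c v w assume "v \<in> carrier V" "w \<in> carrier W"
    then show "?L (gen (c \<odot>\<^bsub>V\<^esub> v) w - Poly_Mapping.single (v, w) c) = \<zero>\<^bsub>U\<^esub>"
      by (intro diff closed_F) (simp_all add: single b simps complex_space_simps[OF U])
  next
    fix c v w assume "v \<in> carrier V" "w \<in> carrier W"
    then show "?L (gen v (c \<odot>\<^bsub>W\<^esub> w) - Poly_Mapping.single (v, w) c) = \<zero>\<^bsub>U\<^esub>"
      by (intro diff closed_F) (simp_all add: single b simps complex_space_simps[OF U])
  qed
qed

text \<open>The linear extension of \<open>\<beta>\<close> kills the relations, so it is constant on each coset, and \<^const>\<open>the_elem\<close>
  in the definition of \<^const>\<open>tensor_lift\<close> picks that common value.\<close>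

lemma tensor_lift_coset:
  assumes V: "complex_space V" and W: "complex_space W" and U: "complex_space U"
    and \<beta>: "\<beta> \<in> bilin_hom V W U" and x: "x \<in> carrier (free_tensor V W)"
  shows "tensor_lift U \<beta> (tensor_null V W +>\<^bsub>free_tensor V W\<^esub> x) = lin_ext U (\<lambda>p. \<beta> (fst p) (snd p)) x"
proof -
  let ?F = "free_tensor V W" and ?N = "tensor_null V W" and ?L = "lin_ext U (\<lambda>p. \<beta> (fst p) (snd p))"
  interpret U: abelian_group U using complex_space_simps(10)[OF U] .
  have L: "?L \<in> lin_hom ?F U"
    using bilin_homD(3)[OF \<beta>] by (intro lin_ext_linear[OF U]) auto
  have N: "subgroup ?N (add_monoid ?F)"
    using submodule_tensor_null[OF V W] by (rule submodule.axioms(1))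
  have "?L n = \<zero>\<^bsub>U\<^esub>" if "n \<in> ?N" for n
    using submodule_gen_kernel[OF complex_space_free U L bilinearity_relations_subset[OF V W]]
      lin_ext_bilinearity_relations[OF V W U \<beta>] that unfolding tensor_null_def by blast
  then have "?L y = ?L x" if "y \<in> ?N +>\<^bsub>?F\<^esub> x" for y
    using that x subgroup.mem_carrier[OF N] lin_homD(1)[OF L x] lin_homD(2)[OF L _ x]
    by (auto simp: a_r_coset_def')
  moreover have "x \<in> ?N +>\<^bsub>?F\<^esub> x"
    using subgroup.one_closed[OF N] by (force simp: a_r_coset_def')
  ultimately have "?L ` (?N +>\<^bsub>?F\<^esub> x) = {?L x}"
    by blast
  then show ?thesis
    by (simp add: tensor_lift_def lin_ext_def)
qed

lemma tensor_lift_linear: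
  assumes V: "complex_space V" and W: "complex_space W" and U: "complex_space U"
    and \<beta>: "\<beta> \<in> bilin_hom V W U"
  shows "tensor_lift U \<beta> \<in> lin_hom (tensor_space V W) U"
proof -
  let ?L = "lin_ext U (\<lambda>p. \<beta> (fst p) (snd p))"
  have L: "?L \<in> lin_hom (free_tensor V W) U"
    using bilin_homD(3)[OF \<beta>] by (intro lin_ext_linear[OF U]) auto
  note L = lin_homD[OF L] and q = lin_homD[OF tensor_coset_linear[OF V W]]
  note F = complex_space_simps[OF complex_space_free]
  note lift = tensor_lift_coset[OF V W U \<beta>]
  show ?thesis
  proof (rule lin_homI)
    fix s t assume "s \<in> carrier (tensor_space V W)" "t \<in> carrier (tensor_space V W)"
    then obtain x y where "x \<in> carrier (free_tensor V W)" "y \<in> carrier (free_tensor V W)"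
      "s = tensor_null V W +>\<^bsub>free_tensor V W\<^esub> x" "t = tensor_null V W +>\<^bsub>free_tensor V W\<^esub> y"
      by (auto simp only: carrier_tensor_space[OF V W])
    then show "tensor_lift U \<beta> (s \<oplus>\<^bsub>tensor_space V W\<^esub> t) = tensor_lift U \<beta> s \<oplus>\<^bsub>U\<^esub> tensor_lift U \<beta> t"
      by (simp only: q(2)[symmetric] lift L F)
  next
    fix c s assume "s \<in> carrier (tensor_space V W)"
    then obtain x where "x \<in> carrier (free_tensor V W)"
      "s = tensor_null V W +>\<^bsub>free_tensor V W\<^esub> x"
      by (auto simp only: carrier_tensor_space[OF V W])
    then show "tensor_lift U \<beta> s \<in> carrier U"
      and "tensor_lift U \<beta> (c \<odot>\<^bsub>tensor_space V W\<^esub> s) = c \<odot>\<^bsub>U\<^esub> tensor_lift U \<beta> s"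
      by (simp_all only: q(3)[symmetric] lift L F)
  qed
qed

lemma tensor_lift_pure:
  assumes V: "complex_space V" and W: "complex_space W" and U: "complex_space U"
    and \<beta>: "\<beta> \<in> bilin_hom V W U" and v: "v \<in> carrier V" and w: "w \<in> carrier W"
  shows "tensor_lift U \<beta> (pure_tensor V W v w) = \<beta> v w"
  using tensor_lift_coset[OF V W U \<beta>, of "gen v w"] v w bilin_homD(3)[OF \<beta> v w]
    lin_ext_single[OF U, of "\<lambda>p. \<beta> (fst p) (snd p)" "(v, w)" 1]
  by (simp add: pure_tensor_def complex_space_simps[OF U])

text \<open>The uniqueness half of the universal property. Every identity between iterated lifts below is
  obtained from it by comparing values on pure tensors.\<close>

lemma tensor_hom_eq:
  assumes V: "complex_space V" and W: "complex_space W" and U: "complex_space U"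
    and f: "f \<in> lin_hom (tensor_space V W) U" and g: "g \<in> lin_hom (tensor_space V W) U"
    and eq: "\<And>v w. \<lbrakk>v \<in> carrier V; w \<in> carrier W\<rbrakk> \<Longrightarrow>
      f (pure_tensor V W v w) = g (pure_tensor V W v w)"
    and t: "t \<in> carrier (tensor_space V W)"
  shows "f t = g t"
proof -
  let ?q = "\<lambda>x. tensor_null V W +>\<^bsub>free_tensor V W\<^esub> x"
  obtain x where x: "x \<in> carrier (free_tensor V W)" "t = ?q x"
    using t by (auto simp only: carrier_tensor_space[OF V W])
  have "f (?q x) = g (?q x)"
    by (rule free_space_hom_eq[OF U lin_hom_comp[OF f tensor_coset_linear[OF V W]]
          lin_hom_comp[OF g tensor_coset_linear[OF V W]]])
      (use x eq in \<open>auto simp: pure_tensor_def\<close>)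
  then show ?thesis
    by (simp add: x)
qed

lemma tensor_lift_comp:
  assumes V: "complex_space V" and W: "complex_space W" and U: "complex_space U"
    and U': "complex_space U'" and f: "f \<in> lin_hom U U'" and \<beta>: "\<beta> \<in> bilin_hom V W U"
    and t: "t \<in> carrier (tensor_space V W)"
  shows "f (tensor_lift U \<beta> t) = tensor_lift U' (\<lambda>v w. f (\<beta> v w)) t"
  by (rule tensor_hom_eq[OF V W U' lin_hom_comp[OF f tensor_lift_linear[OF V W U \<beta>]]
        tensor_lift_linear[OF V W U' bilin_hom_comp[OF f \<beta>]] _ t])
    (simp add: tensor_lift_pure[OF V W U \<beta>] tensor_lift_pure[OF V W U' bilin_hom_comp[OF f \<beta>]])

lemma tensor_lift_cong:
  assumes V: "complex_space V" and W: "complex_space W" and U: "complex_space U"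
    and \<beta>: "\<beta> \<in> bilin_hom V W U" and \<gamma>: "\<gamma> \<in> bilin_hom V W U"
    and eq: "\<And>v w. \<lbrakk>v \<in> carrier V; w \<in> carrier W\<rbrakk> \<Longrightarrow> \<beta> v w = \<gamma> v w"
    and t: "t \<in> carrier (tensor_space V W)"
  shows "tensor_lift U \<beta> t = tensor_lift U \<gamma> t"
  by (rule tensor_hom_eq[OF V W U tensor_lift_linear[OF V W U \<beta>] tensor_lift_linear[OF V W U \<gamma>] _ t])
    (simp add: tensor_lift_pure[OF V W U \<beta>] tensor_lift_pure[OF V W U \<gamma>] eq)

text \<open>The lift of \<open>\<beta> z\<close> is linear in \<open>z\<close> for each fixed tensor: both sides of the equations to be shown are
  linear in the tensor, and on pure tensors they reduce to linearity of \<open>z \<mapsto> \<beta> z v w\<close>.\<close>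

lemma tensor_lift_linear_param:
  assumes V: "complex_space V" and W: "complex_space W" and U: "complex_space U" and Z: "complex_space Z"
    and \<beta>: "\<And>z. z \<in> carrier Z \<Longrightarrow> \<beta> z \<in> bilin_hom V W U"
    and \<beta>': "\<And>v w. \<lbrakk>v \<in> carrier V; w \<in> carrier W\<rbrakk> \<Longrightarrow> (\<lambda>z. \<beta> z v w) \<in> lin_hom Z U"
    and t: "t \<in> carrier (tensor_space V W)"
  shows "(\<lambda>z. tensor_lift U (\<beta> z) t) \<in> lin_hom Z U"
proof (rule lin_homI)
  note Z' = complex_space_simps[OF Z] and U' = complex_space_simps[OF U]
  note lin = tensor_lift_linear[OF V W U \<beta>] and pure = tensor_lift_pure[OF V W U \<beta>]
  fix x y assume x: "x \<in> carrier Z" and y: "y \<in> carrier Z"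
  show "tensor_lift U (\<beta> x) t \<in> carrier U"
    using lin_homD(1)[OF lin[OF x] t] .
  show "tensor_lift U (\<beta> (x \<oplus>\<^bsub>Z\<^esub> y)) t = tensor_lift U (\<beta> x) t \<oplus>\<^bsub>U\<^esub> tensor_lift U (\<beta> y) t"
    by (rule tensor_hom_eq[OF V W U lin lin_hom_plus[OF U lin lin] _ t])
      (use x y in \<open>simp_all add: Z' pure lin_homD(2)[OF \<beta>']\<close>)
  show "tensor_lift U (\<beta> (c \<odot>\<^bsub>Z\<^esub> x)) t = c \<odot>\<^bsub>U\<^esub> tensor_lift U (\<beta> x) t" for c
    by (rule tensor_hom_eq[OF V W U lin lin_hom_scale[OF U lin] _ t])
      (use x in \<open>simp_all add: Z' pure lin_homD(3)[OF \<beta>']\<close>)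
qed

section \<open>Multilinear maps along the coproduct\<close>

lemma lin_hom_cong:
  assumes "complex_space V" "f \<in> lin_hom V W" "\<And>x. x \<in> carrier V \<Longrightarrow> f x = g x"
  shows "g \<in> lin_hom V W"
  using lin_homD[OF assms(2)] complex_space_simps[OF assms(1)] assms(3)
  by (intro lin_homI) metis+

lemma bilin_hom_cong:
  assumes V: "complex_space V" and W: "complex_space W" and \<beta>: "\<beta> \<in> bilin_hom V W U"
    and eq: "\<And>v w. \<lbrakk>v \<in> carrier V; w \<in> carrier W\<rbrakk> \<Longrightarrow> \<beta> v w = \<gamma> v w"
  shows "\<gamma> \<in> bilin_hom V W U"
  by (intro bilin_homI; rule lin_hom_cong[OF _ bilin_homD(1)[OF \<beta>]] lin_hom_cong[OF _ bilin_homD(2)[OF \<beta>]])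
    (use V W eq in auto)

lemma bilin_hom_comp2:
  assumes \<beta>: "\<beta> \<in> bilin_hom V W U" and f: "f \<in> lin_hom V' V" and g: "g \<in> lin_hom W' W"
  shows "(\<lambda>v w. \<beta> (f v) (g w)) \<in> bilin_hom V' W' U"
  using lin_homD(1)[OF f] lin_homD(1)[OF g]
  by (intro bilin_homI lin_hom_comp[OF bilin_homD(1)[OF \<beta>] g] lin_hom_comp[OF bilin_homD(2)[OF \<beta>] f])

lemma tensor_lift_bilinear_param:
  assumes V: "complex_space V" and W: "complex_space W" and U: "complex_space U"
    and Y: "complex_space Y" and Z: "complex_space Z"
    and 1: "\<And>y z. \<lbrakk>y \<in> carrier Y; z \<in> carrier Z\<rbrakk> \<Longrightarrow> \<beta> y z \<in> bilin_hom V W U"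
    and 2: "\<And>v w. \<lbrakk>v \<in> carrier V; w \<in> carrier W\<rbrakk> \<Longrightarrow> (\<lambda>y z. \<beta> y z v w) \<in> bilin_hom Y Z U"
    and t: "t \<in> carrier (tensor_space V W)"
  shows "(\<lambda>y z. tensor_lift U (\<beta> y z) t) \<in> bilin_hom Y Z U"
proof (rule bilin_homI)
  fix y assume y: "y \<in> carrier Y"
  show "(\<lambda>z. tensor_lift U (\<beta> y z) t) \<in> lin_hom Z U"
    by (rule tensor_lift_linear_param[OF V W U Z 1[OF y] bilin_homD(1)[OF 2 y] t])
next
  fix z assume z: "z \<in> carrier Z"
  show "(\<lambda>y. tensor_lift U (\<beta> y z) t) \<in> lin_hom Y U"
    by (rule tensor_lift_linear_param[OF V W U Y 1[OF _ z] bilin_homD(2)[OF 2 z] t])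
qed

context hopf_algebra
begin

lemma space: "complex_space H"
  by unfold_locales

lemma tensor_square: "complex_space (tensor_space H H)"
  by (rule complex_space_tensor[OF space space])

lemma comult_closed: "a \<in> carrier H \<Longrightarrow> comult H a \<in> carrier (tensor_space H H)"
  by (rule lin_homD(1)[OF comult_linear])

text \<open>In Sweedler notation \<open>sweedler \<beta> a\<close> is \<open>\<beta> a\<^sub>1 a\<^sub>2\<close>, the summation over the terms of the coproduct
  being understood. Nested applications express iterated coproducts without ever forming a triple
  tensor product.\<close>

definition sweedler :: "('a \<Rightarrow> 'a \<Rightarrow> 'a) \<Rightarrow> 'a \<Rightarrow> 'a" where
  "sweedler \<beta> a = tensor_lift H \<beta> (comult H a)"

lemma sweedler_comp:
  "\<lbrakk>f \<in> lin_hom H H; \<beta> \<in> bilin_hom H H H; a \<in> carrier H\<rbrakk> \<Longrightarrow>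
    f (sweedler \<beta> a) = sweedler (\<lambda>x y. f (\<beta> x y)) a"
  unfolding sweedler_def by (intro tensor_lift_comp[OF space space space space] comult_closed)

text \<open>Bilinearity depends only on the values on the carrier, so it passes from \<open>\<beta>\<close> to \<open>\<gamma>\<close>.\<close>

lemma sweedler_cong:
  assumes "\<beta> \<in> bilin_hom H H H" "a \<in> carrier H"
    and "\<And>x y. \<lbrakk>x \<in> carrier H; y \<in> carrier H\<rbrakk> \<Longrightarrow> \<beta> x y = \<gamma> x y"
  shows "sweedler \<beta> a = sweedler \<gamma> a"
  unfolding sweedler_def
  using assms bilin_hom_cong[OF space space assms(1,3)] comult_closed
  by (intro tensor_lift_cong[OF space space space]) auto

lemma sweedler_linear_param:
  assumes "\<And>z. z \<in> carrier H \<Longrightarrow> \<beta> z \<in> bilin_hom H H H"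
    and "\<And>x y. \<lbrakk>x \<in> carrier H; y \<in> carrier H\<rbrakk> \<Longrightarrow> (\<lambda>z. \<beta> z x y) \<in> lin_hom H H"
    and "a \<in> carrier H"
  shows "(\<lambda>z. sweedler (\<beta> z) a) \<in> lin_hom H H"
  unfolding sweedler_def
  by (rule tensor_lift_linear_param[OF space space space space assms(1,2) comult_closed[OF assms(3)]])

definition trilin :: "('a \<Rightarrow> 'a \<Rightarrow> 'a \<Rightarrow> 'a) set" where
  "trilin = {\<tau>. (\<forall>x\<in>carrier H. (\<lambda>y z. \<tau> x y z) \<in> bilin_hom H H H) \<and>
     (\<forall>y\<in>carrier H. \<forall>z\<in>carrier H. (\<lambda>x. \<tau> x y z) \<in> lin_hom H H)}"

lemma trilinD:
  assumes "\<tau> \<in> trilin"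
  shows "\<And>x. x \<in> carrier H \<Longrightarrow> (\<lambda>y z. \<tau> x y z) \<in> bilin_hom H H H"
    and "\<And>z. z \<in> carrier H \<Longrightarrow> (\<lambda>x y. \<tau> x y z) \<in> bilin_hom H H H"
    and "\<And>y z. \<lbrakk>y \<in> carrier H; z \<in> carrier H\<rbrakk> \<Longrightarrow> (\<lambda>x. \<tau> x y z) \<in> lin_hom H H"
  using assms by (auto simp: trilin_def bilin_hom_def)

text \<open>\<open>\<tau> a\<^sub>1\<^sub>1 a\<^sub>1\<^sub>2 a\<^sub>2 = \<tau> a\<^sub>1 a\<^sub>2\<^sub>1 a\<^sub>2\<^sub>2\<close>. A trilinear \<open>\<tau>\<close> induces a linear map \<open>\<Phi>\<close> on \<open>H \<otimes> (H \<otimes> H)\<close>, and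
  the two sides are the images under \<open>\<Phi>\<close> of the two sides of coassociativity.\<close>

lemma sweedler_coassoc:
  assumes \<tau>: "\<tau> \<in> trilin" and a: "a \<in> carrier H"
  shows "sweedler (\<lambda>x y. sweedler (\<lambda>u v. \<tau> u v y) x) a = sweedler (\<lambda>x y. sweedler (\<tau> x) y) a"
proof -
  let ?HH = "tensor_space H H"
  let ?R = "tensor_space H ?HH" and ?L = "tensor_space ?HH H"
  have R: "complex_space ?R" and L: "complex_space ?L"
    by (intro complex_space_tensor tensor_square space)+
  note D = comult_closed[OF a]
  have pure3: "(\<lambda>u v. pure_tensor H ?HH u (pure_tensor H H v w)) \<in> bilin_hom H H ?R"
    if "w \<in> carrier H" for w
    by (rule bilin_hom_comp2[OF pure_tensor_bilinear[OF space tensor_square] lin_hom_ident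
          bilin_homD(2)[OF pure_tensor_bilinear[OF space space] that]])
  have \<alpha>: "(\<lambda>s w. tensor_lift ?R (\<lambda>u v. pure_tensor H ?HH u (pure_tensor H H v w)) s) \<in> bilin_hom ?HH H ?R"
  proof (rule bilin_homI)
    fix s assume s: "s \<in> carrier ?HH"
    show "(\<lambda>w. tensor_lift ?R (\<lambda>u v. pure_tensor H ?HH u (pure_tensor H H v w)) s) \<in> lin_hom H ?R"
      by (rule tensor_lift_linear_param[OF space space R space pure3 _ s])
        (assumption | rule lin_hom_comp[OF bilin_homD(1)[OF pure_tensor_bilinear[OF space tensor_square]]
            bilin_homD(1)[OF pure_tensor_bilinear[OF space space]]])+
  next
    fix w assume "w \<in> carrier H"
    then show "(\<lambda>s. tensor_lift ?R (\<lambda>u v. pure_tensor H ?HH u (pure_tensor H H v w)) s) \<in> lin_hom ?HH ?R"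
      by (intro tensor_lift_linear[OF space space R] pure3)
  qed
  have \<alpha>_lin: "tensor_assoc H H H \<in> lin_hom ?L ?R"
    unfolding tensor_assoc_def by (rule tensor_lift_linear[OF tensor_square space R \<alpha>])
  have \<tau>': "(\<lambda>x t. tensor_lift H (\<tau> x) t) \<in> bilin_hom H ?HH H"
    by (intro bilin_homI tensor_lift_linear[OF space space space]
        tensor_lift_linear_param[OF space space space space] trilinD[OF \<tau>])
  let ?\<Phi> = "tensor_lift H (\<lambda>x t. tensor_lift H (\<tau> x) t)"
  have \<Phi>: "?\<Phi> \<in> lin_hom ?R H"
    by (rule tensor_lift_linear[OF space tensor_square space \<tau>'])
  have \<Phi>_pure: "?\<Phi> (pure_tensor H ?HH x t) = tensor_lift H (\<tau> x) t"
    if "x \<in> carrier H" "t \<in> carrier ?HH" for x t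
    using tensor_lift_pure[OF space tensor_square space \<tau>' that] .
  have left: "(\<lambda>x y. pure_tensor ?HH H (comult H x) (id y)) \<in> bilin_hom H H ?L"
    using bilin_hom_comp2[OF pure_tensor_bilinear[OF tensor_square space] comult_linear lin_hom_ident] by simp
  have right: "(\<lambda>x y. pure_tensor H ?HH (id x) (comult H y)) \<in> bilin_hom H H ?R"
    using bilin_hom_comp2[OF pure_tensor_bilinear[OF space tensor_square] lin_hom_ident comult_linear] by simp
  have \<Phi>_assoc: "?\<Phi> (tensor_assoc H H H (pure_tensor ?HH H s w)) = tensor_lift H (\<lambda>u v. \<tau> u v w) s"
    if s: "s \<in> carrier ?HH" and w: "w \<in> carrier H" for s w
  proof -
    have "?\<Phi> (tensor_assoc H H H (pure_tensor ?HH H s w)) =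
        ?\<Phi> (tensor_lift ?R (\<lambda>u v. pure_tensor H ?HH u (pure_tensor H H v w)) s)"
      unfolding tensor_assoc_def by (subst tensor_lift_pure[OF tensor_square space R \<alpha> s w]) (rule refl)
    also have "\<dots> = tensor_lift H (\<lambda>u v. ?\<Phi> (pure_tensor H ?HH u (pure_tensor H H v w))) s"
      by (rule tensor_lift_comp[OF space space R space \<Phi> pure3[OF w] s])
    also have "\<dots> = tensor_lift H (\<lambda>u v. \<tau> u v w) s"
    proof (rule tensor_lift_cong[OF space space space bilin_hom_comp[OF \<Phi> pure3[OF w]] trilinD(2)[OF \<tau> w] _ s])
      fix u v assume u: "u \<in> carrier H" and v: "v \<in> carrier H"
      show "?\<Phi> (pure_tensor H ?HH u (pure_tensor H H v w)) = \<tau> u v w"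
        using \<Phi>_pure[OF u pure_tensor_closed[OF space space v w]]
          tensor_lift_pure[OF space space space trilinD(1)[OF \<tau> u] v w] by simp
    qed
    finally show ?thesis .
  qed
  have "?\<Phi> (tensor_assoc H H H (tensor_map ?HH H (comult H) id (comult H a))) =
      tensor_lift H (\<lambda>x y. ?\<Phi> (tensor_assoc H H H (pure_tensor ?HH H (comult H x) (id y)))) (comult H a)"
    unfolding tensor_map_def
    by (rule tensor_lift_comp[OF space space L space lin_hom_comp[OF \<Phi> \<alpha>_lin] left D])
  also have "\<dots> = sweedler (\<lambda>x y. sweedler (\<lambda>u v. \<tau> u v y) x) a"
    unfolding sweedler_def[symmetric, of _ a]
    by (rule sweedler_cong[OF bilin_hom_comp[OF lin_hom_comp[OF \<Phi> \<alpha>_lin] left] a])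
      (simp add: \<Phi>_assoc comult_closed sweedler_def)
  finally have 1: "?\<Phi> (tensor_assoc H H H (tensor_map ?HH H (comult H) id (comult H a))) =
    sweedler (\<lambda>x y. sweedler (\<lambda>u v. \<tau> u v y) x) a" .
  have "?\<Phi> (tensor_map H ?HH id (comult H) (comult H a)) =
      tensor_lift H (\<lambda>x y. ?\<Phi> (pure_tensor H ?HH (id x) (comult H y))) (comult H a)"
    unfolding tensor_map_def by (rule tensor_lift_comp[OF space space R space \<Phi> right D])
  also have "\<dots> = sweedler (\<lambda>x y. sweedler (\<tau> x) y) a"
    unfolding sweedler_def[symmetric, of _ a]
    by (rule sweedler_cong[OF bilin_hom_comp[OF \<Phi> right] a])
      (simp add: \<Phi>_pure comult_closed sweedler_def)
  finally show ?thesis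
    using 1 coassoc[OF a] by simp
qed

lemma mult_bilinear: "(\<lambda>x y. x \<otimes> y) \<in> bilin_hom H H H"
  by (intro bilin_homI lin_homI) (simp_all add: smult_mult_left smult_mult_right A.l_distr A.r_distr)

text \<open>\<open>\<beta> (ab)\<^sub>1 (ab)\<^sub>2 = \<beta> (a\<^sub>1 b\<^sub>1) (a\<^sub>2 b\<^sub>2)\<close>: the coproduct is multiplicative for the product of \<open>H \<otimes> H\<close>.
  The sum over the terms of \<open>\<Delta> b\<close> is the inner one.\<close>

lemma sweedler_mult:
  assumes \<beta>: "\<beta> \<in> bilin_hom H H H" and a: "a \<in> carrier H" and b: "b \<in> carrier H"
  shows "sweedler \<beta> (a \<otimes> b) = sweedler (\<lambda>x y. sweedler (\<lambda>u v. \<beta> (x \<otimes> u) (y \<otimes> v)) b) a"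
proof -
  let ?HH = "tensor_space H H"
  note bil = bilin_hom_comp2[OF _ bilin_homD(1)[OF mult_bilinear] bilin_homD(1)[OF mult_bilinear]]
    bilin_hom_comp2[OF _ bilin_homD(2)[OF mult_bilinear] bilin_homD(2)[OF mult_bilinear]]
  note pure = pure_tensor_bilinear[OF space space]
  have inner: "(\<lambda>u v. pure_tensor H H (x \<otimes> u) (y \<otimes> v)) \<in> bilin_hom H H ?HH"
    if "x \<in> carrier H" "y \<in> carrier H" for x y
    by (rule bil(1)[OF pure that])
  have outer: "(\<lambda>x y. tensor_lift ?HH (\<lambda>u v. pure_tensor H H (x \<otimes> u) (y \<otimes> v)) (comult H b)) \<in> bilin_hom H H ?HH"
    by (rule tensor_lift_bilinear_param[OF space space tensor_square space space inner bil(2)[OF pure] comult_closed[OF b]])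
  let ?f = "tensor_lift H \<beta>"
  have f: "?f \<in> lin_hom ?HH H"
    by (rule tensor_lift_linear[OF space space space \<beta>])
  have "sweedler \<beta> (a \<otimes> b) = ?f (tensor_lift ?HH (\<lambda>x y. tensor_lift ?HH
      (\<lambda>u v. pure_tensor H H (x \<otimes> u) (y \<otimes> v)) (comult H b)) (comult H a))"
    using comult_mult[OF a b] by (simp add: sweedler_def tensor_algebra_def)
  also have "\<dots> = sweedler (\<lambda>x y. ?f (tensor_lift ?HH (\<lambda>u v. pure_tensor H H (x \<otimes> u) (y \<otimes> v)) (comult H b))) a"
    unfolding sweedler_def[of _ a]
    by (rule tensor_lift_comp[OF space space tensor_square space f outer comult_closed[OF a]])
  also have "\<dots> = sweedler (\<lambda>x y. sweedler (\<lambda>u v. \<beta> (x \<otimes> u) (y \<otimes> v)) b) a"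
  proof (rule sweedler_cong[OF bilin_hom_comp[OF f outer] a])
    fix x y assume xy: "x \<in> carrier H" "y \<in> carrier H"
    have "?f (tensor_lift ?HH (\<lambda>u v. pure_tensor H H (x \<otimes> u) (y \<otimes> v)) (comult H b)) =
        sweedler (\<lambda>u v. ?f (pure_tensor H H (x \<otimes> u) (y \<otimes> v))) b"
      unfolding sweedler_def
      by (rule tensor_lift_comp[OF space space tensor_square space f inner[OF xy] comult_closed[OF b]])
    also have "\<dots> = sweedler (\<lambda>u v. \<beta> (x \<otimes> u) (y \<otimes> v)) b"
      by (rule sweedler_cong[OF bilin_hom_comp[OF f inner[OF xy]] b])
        (use xy in \<open>simp add: tensor_lift_pure[OF space space space \<beta>]\<close>)
    finally show "?f (tensor_lift ?HH (\<lambda>u v. pure_tensor H H (x \<otimes> u) (y \<otimes> v)) (comult H b)) =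
      sweedler (\<lambda>u v. \<beta> (x \<otimes> u) (y \<otimes> v)) b" .
  qed
  finally show ?thesis .
qed

section \<open>The antipode reverses products\<close>

lemma antipode_closed [simp]: "a \<in> carrier H \<Longrightarrow> antipode H a \<in> carrier H"
  by (rule lin_homD(1)[OF antipode_linear])

lemma lin_hom_mult_left: "\<lbrakk>c \<in> carrier H; f \<in> lin_hom V H\<rbrakk> \<Longrightarrow> (\<lambda>x. c \<otimes> f x) \<in> lin_hom V H"
  by (rule lin_hom_comp[OF bilin_homD(1)[OF mult_bilinear]])

lemma lin_hom_mult_right: "\<lbrakk>c \<in> carrier H; f \<in> lin_hom V H\<rbrakk> \<Longrightarrow> (\<lambda>x. f x \<otimes> c) \<in> lin_hom V H"
  by (rule lin_hom_comp[OF bilin_homD(2)[OF mult_bilinear]])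

lemma lin_hom_counit_smult: "c \<in> carrier H \<Longrightarrow> (\<lambda>x. counit H x \<odot> c) \<in> lin_hom H H"
  using lin_homD[OF counit_linear] by (intro lin_homI) (simp_all add: complex_space_simps[OF space])

lemmas lin_intros = lin_hom_ident lin_hom_mult_left lin_hom_mult_right lin_hom_counit_smult
  lin_hom_scale[OF space] lin_hom_comp[OF antipode_linear]

lemma antipode_one: "antipode H \<one> = \<one>"
proof -
  have "(\<lambda>x y. antipode H x \<otimes> y) \<in> bilin_hom H H H"
    by (intro bilin_homI lin_intros) simp_all
  then have "antipode H \<one> \<otimes> \<one> = tensor_lift H (\<lambda>x y. antipode H x \<otimes> y) (comult H \<one>)"
    unfolding comult_one by (simp add: tensor_algebra_def tensor_lift_pure[OF space space space])
  also have "\<dots> = \<one>"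
    using antipode_left[OF A.one_closed] counit_one by (simp add: complex_space_simps[OF space])
  finally show ?thesis
    by simp
qed

text \<open>\<open>b\<^sub>1 S(a b\<^sub>2) = \<epsilon>(b) S(a)\<close>. Writing \<open>L a\<close> for the left side, insert \<open>S(a\<^sub>1) a\<^sub>2 = \<epsilon>(a) 1\<close>:
  \<open>L a = S(a\<^sub>1) a\<^sub>2 L(a\<^sub>3) = S(a\<^sub>1) a\<^sub>2 b\<^sub>1 S(a\<^sub>3 b\<^sub>2)\<close>. The last three factors are \<open>x\<^sub>1 S(x\<^sub>2)\<close> for
  \<open>x = a\<^sub>2 b\<close>, so they collapse to \<open>\<epsilon>(a\<^sub>2) \<epsilon>(b)\<close>. Dealing with one factor at a time in this way keeps the
  coassociativity arguments to a single variable and avoids interchanging sums over \<open>a\<close> and \<open>b\<close>.\<close>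

lemma sweedler_mult_antipode_mult:
  assumes a: "a \<in> carrier H" and b: "b \<in> carrier H"
  shows "sweedler (\<lambda>x y. x \<otimes> antipode H (a \<otimes> y)) b = counit H b \<odot> antipode H a"
proof -
  note smult = smult_mult_left smult_mult_right complex_space_simps[OF space]
  define L where "L = (\<lambda>z. sweedler (\<lambda>x y. x \<otimes> antipode H (z \<otimes> y)) b)"
  have \<beta>: "(\<lambda>x y. x \<otimes> antipode H (z \<otimes> y)) \<in> bilin_hom H H H" if "z \<in> carrier H" for z
    using that by (intro bilin_homI lin_intros) simp_all
  have L: "L \<in> lin_hom H H"
    unfolding L_def using \<beta> b by (intro sweedler_linear_param lin_intros) simp_all
  note L_closed [simp] = lin_homD(1)[OF L]
  note intros = lin_intros lin_hom_comp[OF L]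
  \<comment> \<open>\<open>v\<^sub>1 L(v\<^sub>2) = v\<^sub>1 b\<^sub>1 S(v\<^sub>2 b\<^sub>2)\<close>, which the antipode axiom for \<open>v b\<close> evaluates\<close>
  have conv: "sweedler (\<lambda>p q. p \<otimes> L q) v = (counit H v * counit H b) \<odot> \<one>" if v: "v \<in> carrier H" for v
  proof -
    have "(\<lambda>p q. p \<otimes> L q) \<in> bilin_hom H H H"
      by (intro bilin_homI intros) simp_all
    then have "sweedler (\<lambda>p q. p \<otimes> L q) v =
        sweedler (\<lambda>p q. sweedler (\<lambda>x y. (p \<otimes> x) \<otimes> antipode H (q \<otimes> y)) b) v"
    proof (rule sweedler_cong[OF _ v])
      fix p q assume pq: "p \<in> carrier H" "q \<in> carrier H"
      have "p \<otimes> L q = sweedler (\<lambda>x y. p \<otimes> (x \<otimes> antipode H (q \<otimes> y))) b"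
        unfolding L_def using pq b by (intro sweedler_comp \<beta> lin_intros)
      also have "\<dots> = sweedler (\<lambda>x y. (p \<otimes> x) \<otimes> antipode H (q \<otimes> y)) b"
        using pq b by (intro sweedler_cong bilin_hom_comp[OF _ \<beta>] lin_intros) (simp_all add: A.m_assoc)
      finally show "p \<otimes> L q = sweedler (\<lambda>x y. (p \<otimes> x) \<otimes> antipode H (q \<otimes> y)) b" .
    qed
    also have "\<dots> = sweedler (\<lambda>x y. x \<otimes> antipode H y) (v \<otimes> b)"
      using v b by (intro sweedler_mult[symmetric] bilin_homI lin_intros) simp_all
    also have "\<dots> = (counit H v * counit H b) \<odot> \<one>"
      using antipode_right[of "v \<otimes> b"] counit_mult[OF v b] v b by (simp add: sweedler_def)
    finally show ?thesis .
  qed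
  have tri: "(\<lambda>p q v. antipode H p \<otimes> q \<otimes> L v) \<in> trilin"
    unfolding trilin_def by (auto intro!: bilin_homI intros)
  have "L a = L (sweedler (\<lambda>u v. counit H u \<odot> v) a)"
    using counit_left[OF a] by (simp add: sweedler_def)
  also have "\<dots> = sweedler (\<lambda>u v. L (counit H u \<odot> v)) a"
    using a by (intro sweedler_comp L bilin_homI lin_intros)
  also have "\<dots> = sweedler (\<lambda>u v. sweedler (\<lambda>p q. antipode H p \<otimes> q \<otimes> L v) u) a"
  proof (rule sweedler_cong[OF _ a])
    show "(\<lambda>u v. L (counit H u \<odot> v)) \<in> bilin_hom H H H"
      by (intro bilin_hom_comp[OF L] bilin_homI lin_intros)
    fix u v assume uv: "u \<in> carrier H" "v \<in> carrier H"
    have "L (counit H u \<odot> v) = (counit H u \<odot> \<one>) \<otimes> L v"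
      using uv lin_homD(3)[OF L, of v] by (simp add: smult)
    also have "counit H u \<odot> \<one> = sweedler (\<lambda>p q. antipode H p \<otimes> q) u"
      using antipode_left[OF uv(1)] by (simp add: sweedler_def)
    also have "\<dots> \<otimes> L v = sweedler (\<lambda>p q. antipode H p \<otimes> q \<otimes> L v) u"
      using uv by (intro sweedler_comp[where f = "\<lambda>x. x \<otimes> L v"] bilin_homI lin_intros) simp_all
    finally show "L (counit H u \<odot> v) = sweedler (\<lambda>p q. antipode H p \<otimes> q \<otimes> L v) u" .
  qed
  also have "\<dots> = sweedler (\<lambda>u v. sweedler (\<lambda>p q. antipode H u \<otimes> p \<otimes> L q) v) a"
    by (rule sweedler_coassoc[OF tri a])
  also have "\<dots> = sweedler (\<lambda>u v. counit H b \<odot> antipode H (counit H v \<odot> u)) a"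
  proof (rule sweedler_cong[OF _ a, symmetric])
    show "(\<lambda>u v. counit H b \<odot> antipode H (counit H v \<odot> u)) \<in> bilin_hom H H H"
      by (intro bilin_homI lin_intros)
    fix u v assume uv: "u \<in> carrier H" "v \<in> carrier H"
    have "sweedler (\<lambda>p q. antipode H u \<otimes> p \<otimes> L q) v = sweedler (\<lambda>p q. antipode H u \<otimes> (p \<otimes> L q)) v"
      using uv by (intro sweedler_cong bilin_homI intros) (simp_all add: A.m_assoc)
    also have "\<dots> = antipode H u \<otimes> sweedler (\<lambda>p q. p \<otimes> L q) v"
      using uv by (intro sweedler_comp[symmetric] bilin_homI intros) simp_all
    also have "\<dots> = counit H b \<odot> antipode H (counit H v \<odot> u)"
      using uv conv[OF uv(2)] lin_homD(3)[OF antipode_linear uv(1)]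
      by (simp add: smult mult.commute flip: smult(6))
    finally show "counit H b \<odot> antipode H (counit H v \<odot> u) = sweedler (\<lambda>p q. antipode H u \<otimes> p \<otimes> L q) v"
      by simp
  qed
  also have "\<dots> = counit H b \<odot> antipode H (sweedler (\<lambda>u v. counit H v \<odot> u) a)"
    using a by (intro sweedler_comp[symmetric, where f = "\<lambda>x. counit H b \<odot> antipode H x"] bilin_homI lin_intros)
  also have "\<dots> = counit H b \<odot> antipode H a"
    using counit_right[OF a] by (simp add: sweedler_def)
  finally show ?thesis
    by (simp add: L_def)
qed

text \<open>\<open>S(ab) = \<epsilon>(b\<^sub>1) S(a b\<^sub>2) = S(b\<^sub>1) b\<^sub>2 S(a b\<^sub>3) = S(b\<^sub>1) \<epsilon>(b\<^sub>2) S(a) = S(b) S(a)\<close>, by coassociativity in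
  \<open>b\<close> and the preceding lemma.\<close>

lemma antipode_mult:
  assumes a: "a \<in> carrier H" and b: "b \<in> carrier H"
  shows "antipode H (a \<otimes> b) = antipode H b \<otimes> antipode H a"
proof -
  note smult = smult_mult_left smult_mult_right complex_space_simps[OF space]
  have f: "(\<lambda>y. antipode H (a \<otimes> y)) \<in> lin_hom H H"
    using a by (intro lin_intros)
  have tri: "(\<lambda>p q y. antipode H p \<otimes> q \<otimes> antipode H (a \<otimes> y)) \<in> trilin"
    unfolding trilin_def using a by (auto intro!: bilin_homI lin_intros)
  have "antipode H (a \<otimes> b) = antipode H (a \<otimes> sweedler (\<lambda>x y. counit H x \<odot> y) b)"
    using counit_left[OF b] by (simp add: sweedler_def)
  also have "\<dots> = sweedler (\<lambda>x y. antipode H (a \<otimes> (counit H x \<odot> y))) b"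
    using b by (intro sweedler_comp[OF f] bilin_homI lin_intros)
  also have "\<dots> = sweedler (\<lambda>x y. sweedler (\<lambda>p q. antipode H p \<otimes> q \<otimes> antipode H (a \<otimes> y)) x) b"
  proof (rule sweedler_cong[OF _ b])
    show "(\<lambda>x y. antipode H (a \<otimes> (counit H x \<odot> y))) \<in> bilin_hom H H H"
      using a by (intro bilin_homI lin_intros)
    fix x y assume xy: "x \<in> carrier H" "y \<in> carrier H"
    have "antipode H (a \<otimes> (counit H x \<odot> y)) = (counit H x \<odot> \<one>) \<otimes> antipode H (a \<otimes> y)"
      using a xy lin_homD(3)[OF f, of y] by (simp add: smult)
    also have "counit H x \<odot> \<one> = sweedler (\<lambda>p q. antipode H p \<otimes> q) x"
      using antipode_left[OF xy(1)] by (simp add: sweedler_def)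
    also have "\<dots> \<otimes> antipode H (a \<otimes> y) = sweedler (\<lambda>p q. antipode H p \<otimes> q \<otimes> antipode H (a \<otimes> y)) x"
      using a xy by (intro sweedler_comp[where f = "\<lambda>z. z \<otimes> antipode H (a \<otimes> y)"] bilin_homI lin_intros) simp_all
    finally show "antipode H (a \<otimes> (counit H x \<odot> y)) =
      sweedler (\<lambda>p q. antipode H p \<otimes> q \<otimes> antipode H (a \<otimes> y)) x" .
  qed
  also have "\<dots> = sweedler (\<lambda>x y. sweedler (\<lambda>p q. antipode H x \<otimes> p \<otimes> antipode H (a \<otimes> q)) y) b"
    by (rule sweedler_coassoc[OF tri b])
  also have "\<dots> = sweedler (\<lambda>x y. antipode H (counit H y \<odot> x) \<otimes> antipode H a) b"
  proof (rule sweedler_cong[OF _ b, symmetric])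
    show "(\<lambda>x y. antipode H (counit H y \<odot> x) \<otimes> antipode H a) \<in> bilin_hom H H H"
      using a by (intro bilin_homI lin_intros) simp_all
    fix x y assume xy: "x \<in> carrier H" "y \<in> carrier H"
    have "sweedler (\<lambda>p q. antipode H x \<otimes> p \<otimes> antipode H (a \<otimes> q)) y =
        sweedler (\<lambda>p q. antipode H x \<otimes> (p \<otimes> antipode H (a \<otimes> q))) y"
      using a xy by (intro sweedler_cong bilin_homI lin_intros) (simp_all add: A.m_assoc)
    also have "\<dots> = antipode H x \<otimes> sweedler (\<lambda>p q. p \<otimes> antipode H (a \<otimes> q)) y"
      using a xy by (intro sweedler_comp[symmetric] bilin_homI lin_intros) simp_all
    also have "\<dots> = antipode H (counit H y \<odot> x) \<otimes> antipode H a"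
      using a xy sweedler_mult_antipode_mult[OF a xy(2)] lin_homD(3)[OF antipode_linear xy(1)]
      by (simp add: smult)
    finally show "antipode H (counit H y \<odot> x) \<otimes> antipode H a =
      sweedler (\<lambda>p q. antipode H x \<otimes> p \<otimes> antipode H (a \<otimes> q)) y"
      by simp
  qed
  also have "\<dots> = antipode H (sweedler (\<lambda>x y. counit H y \<odot> x) b) \<otimes> antipode H a"
    using a b by (intro sweedler_comp[symmetric, where f = "\<lambda>z. antipode H z \<otimes> antipode H a"] bilin_homI lin_intros)
      simp_all
  also have "\<dots> = antipode H b \<otimes> antipode H a"
    using counit_right[OF b] by (simp add: sweedler_def)
  finally show ?thesis .
qed

end

section \<open>The conjugate module\<close>

lemma conj_space_carrier [simp]: "carrier (conj_space bar V) = bar ` carrier V"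
  by (simp add: conj_space_def)

lemma complex_space_conj:
  fixes V (structure)
  assumes bar: "inj bar" and V: "complex_space V"
  shows "complex_space (conj_space bar V)"
proof (rule complex_spaceI)
  interpret V: abelian_group V using complex_space_simps(10)[OF V] .
  note bar' = conj_space_add[OF bar] conj_space_smult[OF bar]
  have zero: "\<zero>\<^bsub>conj_space bar V\<^esub> = bar \<zero>"
    by (simp add: conj_space_def)
  show "abelian_group (conj_space bar V)"
  proof (rule abelian_groupI)
    fix x assume "x \<in> carrier (conj_space bar V)"
    then obtain v where "v \<in> carrier V" "x = bar v"
      by auto
    then show "\<exists>y\<in>carrier (conj_space bar V). y \<oplus>\<^bsub>conj_space bar V\<^esub> x = \<zero>\<^bsub>conj_space bar V\<^esub>"
      by (intro bexI[of _ "bar (\<ominus> v)"]) (simp_all add: bar' zero V.l_neg)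
  qed (auto simp: bar' zero V.a_ac)
qed (auto simp: conj_space_add[OF bar] conj_space_smult[OF bar] complex_space_simps[OF V])

lemma conj_hmodule_simps [simp]:
  "carrier (conj_hmodule H bar V) = carrier (conj_space bar V)"
  "add (conj_hmodule H bar V) = add (conj_space bar V)"
  "zero (conj_hmodule H bar V) = zero (conj_space bar V)"
  "smult (conj_hmodule H bar V) = smult (conj_space bar V)"
  by (simp_all add: conj_hmodule_def hmodule.defs module.defs)

text \<open>\<^const>\<open>conj_hmodule\<close> is an extension of the record \<^const>\<open>conj_space\<close>, hence of a different type; this
  lemma transfers the vector space axioms, which see only the four fields.\<close>

lemma complex_space_cong:
  assumes V: "complex_space V"
    and "carrier W = carrier V" "add W = add V" "zero W = zero V" "smult W = smult V"
  shows "complex_space W"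
proof (rule complex_spaceI)
  interpret V: abelian_group V using complex_space_simps(10)[OF V] .
  show "abelian_group W"
    by (rule abelian_groupI) (use assms(2-) V.l_neg in \<open>auto simp: V.a_ac intro!: bexI[of _ "\<ominus>\<^bsub>V\<^esub> _"]\<close>)
qed (use assms(2-) complex_space_simps[OF V] in simp_all)

lemma (in hopf_star_algebra) star_one: "star H \<one> = \<one>"
proof -
  have "star H \<one> = star H \<one> \<otimes> star H (star H \<one>)"
    using star_closed[of \<one>] by (simp add: star_star)
  also have "\<dots> = star H (star H \<one> \<otimes> \<one>)"
    using star_mult[of "star H \<one>" \<one>] star_closed[of \<one>] by simp
  also have "\<dots> = \<one>"
    using star_closed[of \<one>] by (simp add: star_star)
  finally show ?thesis .
qed

text \<open>The map \<open>\<sigma>(a) = S(a)\<^sup>*\<close> through which \<open>H\<close> acts on the conjugate is antilinear, since \<open>S\<close> is linear and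
  the star antilinear; the conjugate scalars compensate for that. It is multiplicative and unital because
  both \<open>S\<close> and the star reverse products and preserve the unit.\<close>

lemma left_hmodule_conj:
  fixes H :: "('h, 'l) hopf_star_scheme"
  assumes H: "hopf_star_algebra H" and bar: "inj bar" and V: "left_hmodule H V"
  shows "left_hmodule H (conj_hmodule H bar V)"
proof -
  interpret H: hopf_star_algebra H by fact
  interpret V: left_hmodule H V by fact
  have V_space: "complex_space V"
    by unfold_locales
  have conj: "complex_space (conj_hmodule H bar V)"
    by (rule complex_space_cong[OF complex_space_conj[OF bar V_space]]) simp_all
  let ?\<sigma> = "\<lambda>a. star H (antipode H a)"
  have \<sigma>: "?\<sigma> a \<in> carrier H" if "a \<in> carrier H" for a
    using that by (simp add: H.star_closed)
  note S = lin_homD[OF H.antipode_linear]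
  note act = lin_homD[OF V.act_linear]
  note bar' = conj_space_add[OF bar] conj_space_smult[OF bar] conj_hmodule_act[OF bar]
  show ?thesis
  proof (intro left_hmodule.intro left_hmodule_axioms.intro)
    show "complex_algebra H"
      by (rule H.complex_algebra_axioms)
    show "complex_space (conj_hmodule H bar V)"
      by (rule conj)
  next
    fix a assume a: "a \<in> carrier H"
    show "act (conj_hmodule H bar V) a \<in> lin_hom (conj_hmodule H bar V) (conj_hmodule H bar V)"
      using act[OF \<sigma>[OF a]] by (intro lin_homI) (auto simp: bar')
  next
    fix a b x assume "a \<in> carrier H" "b \<in> carrier H" "x \<in> carrier (conj_hmodule H bar V)"
    then show "act (conj_hmodule H bar V) (a \<oplus>\<^bsub>H\<^esub> b) x =
        act (conj_hmodule H bar V) a x \<oplus>\<^bsub>conj_hmodule H bar V\<^esub> act (conj_hmodule H bar V) b x"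
      and "act (conj_hmodule H bar V) (a \<otimes>\<^bsub>H\<^esub> b) x =
        act (conj_hmodule H bar V) a (act (conj_hmodule H bar V) b x)"
      by (auto simp: bar' S H.star_add V.act_add H.antipode_mult H.star_mult V.act_mult \<sigma>)
  next
    fix a c x assume "a \<in> carrier H" "x \<in> carrier (conj_hmodule H bar V)"
    then show "act (conj_hmodule H bar V) (c \<odot>\<^bsub>H\<^esub> a) x =
        c \<odot>\<^bsub>conj_hmodule H bar V\<^esub> act (conj_hmodule H bar V) a x"
      by (auto simp: bar' S H.star_smult V.act_smult \<sigma>)
  next
    fix x assume "x \<in> carrier (conj_hmodule H bar V)"
    then show "act (conj_hmodule H bar V) \<one>\<^bsub>H\<^esub> x = x"
      by (auto simp: bar' H.antipode_one H.star_one V.act_one)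
  qed
qed

lemma conj_map_hmod_hom:
  fixes H :: "('h, 'l) hopf_star_scheme"
  assumes H: "hopf_star_algebra H" and bar: "inj bar" "inj bar'"
    and V: "left_hmodule H V" and T: "T \<in> hmod_hom H V W"
  shows "conj_map bar bar' V T \<in> hmod_hom H (conj_hmodule H bar V) (conj_hmodule H bar' W)"
proof -
  interpret H: hopf_star_algebra H by fact
  interpret V: left_hmodule H V by fact
  have V_space: "complex_space V"
    by unfold_locales
  have T': "T \<in> lin_hom V W"
    and T_act: "\<And>a v. \<lbrakk>a \<in> carrier H; v \<in> carrier V\<rbrakk> \<Longrightarrow> T (act V a v) = act W a (T v)"
    using T by (auto simp: hmod_hom_def)
  note T' = lin_homD[OF T'] and act = lin_homD[OF V.act_linear]
  note bar' = conj_space_add[OF bar(1)] conj_space_smult[OF bar(1)] conj_hmodule_act[OF bar(1)]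
    conj_space_add[OF bar(2)] conj_space_smult[OF bar(2)] conj_hmodule_act[OF bar(2)]
    conj_map_bar[OF bar(1)]
  have "conj_map bar bar' V T \<in> lin_hom (conj_hmodule H bar V) (conj_hmodule H bar' W)"
    by (rule lin_homI) (auto simp: bar' T' complex_space_simps[OF V_space])
  moreover have "conj_map bar bar' V T \<in> extensional (carrier (conj_hmodule H bar V))"
    by (simp add: conj_map_def)
  moreover have "conj_map bar bar' V T (act (conj_hmodule H bar V) a x) =
      act (conj_hmodule H bar' W) a (conj_map bar bar' V T x)"
    if "a \<in> carrier H" "x \<in> carrier (conj_hmodule H bar V)" for a x
    using that by (auto simp: bar' T_act act H.star_closed)
  ultimately show ?thesis
    by (simp add: hmod_hom_def)
qed

section \<open>Functoriality\<close>

lemma category_HMod: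
  fixes H :: "(complex, 'h, 'l) module_scheme"
  shows "category (HMod H :: (('h, 'v) hmodule, 'v \<Rightarrow> 'v) category)"
proof
  fix X :: "('h, 'v) hmodule" assume "X \<in> Obj (HMod H)"
  then interpret X: left_hmodule H X by (simp add: HMod_def)
  have X: "complex_space X"
    by unfold_locales
  show "Ident (HMod H) X \<in> Hom (HMod H) X X"
    using lin_homD(1)[OF X.act_linear] complex_space_simps[OF X]
    by (auto simp: HMod_def hmod_hom_def intro!: lin_homI)
next
  fix X Y Z :: "('h, 'v) hmodule" and f g
  assume "X \<in> Obj (HMod H)" and *: "f \<in> Hom (HMod H) X Y" "g \<in> Hom (HMod H) Y Z"
  then interpret X: left_hmodule H X by (simp add: HMod_def)
  have X: "complex_space X"
    by unfold_locales
  have f: "f \<in> lin_hom X Y" "\<And>a v. \<lbrakk>a \<in> carrier H; v \<in> carrier X\<rbrakk> \<Longrightarrow> f (act X a v) = act Y a (f v)"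
    and g: "g \<in> lin_hom Y Z" "\<And>a v. \<lbrakk>a \<in> carrier H; v \<in> carrier Y\<rbrakk> \<Longrightarrow> g (act Y a v) = act Z a (g v)"
    using * by (auto simp: HMod_def hmod_hom_def)
  have "compose (carrier X) g f \<in> lin_hom X Z"
    by (rule lin_hom_cong[OF X lin_hom_comp[OF g(1) f(1)]]) (simp add: compose_def)
  then show "Comp (HMod H) X Y Z g f \<in> Hom (HMod H) X Z"
    using lin_homD(1)[OF X.act_linear] lin_homD(1)[OF f(1)] f(2) g(2)
    by (simp add: HMod_def hmod_hom_def compose_def)
next
  fix X Y :: "('h, 'v) hmodule" and f
  assume "f \<in> Hom (HMod H) X Y"
  then have f: "f \<in> carrier X \<rightarrow> carrier Y" "f \<in> extensional (carrier X)"
    by (auto simp: HMod_def hmod_hom_def lin_hom_def)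
  show "Comp (HMod H) X Y Y (Ident (HMod H) Y) f = f"
    using f by (simp add: HMod_def Id_compose)
  show "Comp (HMod H) X X Y f (Ident (HMod H) X) = f"
    using f by (simp add: HMod_def compose_Id)
next
  fix W X Y Z :: "('h, 'v) hmodule" and f g h
  assume "f \<in> Hom (HMod H) W X" 
  then have "f \<in> carrier W \<rightarrow> carrier X"
    by (auto simp: HMod_def hmod_hom_def lin_hom_def)
  then show "Comp (HMod H) W X Z (Comp (HMod H) X Y Z h g) f =
      Comp (HMod H) W Y Z h (Comp (HMod H) W X Y g f)"
    by (auto simp: HMod_def compose_def Pi_iff fun_eq_iff restrict_def)
qed

lemma endofunctor_conj:
  fixes H :: "('h, 'l) hopf_star_scheme" and bar :: "'v \<Rightarrow> 'v"
  assumes H: "hopf_star_algebra H" and bar: "inj bar"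
  shows "endofunctor (HMod H :: (('h, 'v) hmodule, 'v \<Rightarrow> 'v) category)
      (conj_hmodule H bar) (\<lambda>V W. conj_map bar bar V)"
proof (intro cat_functor.intro cat_functor_axioms.intro category_HMod)
  fix X :: "('h, 'v) hmodule" assume "X \<in> Obj (HMod H)"
  then show "conj_hmodule H bar X \<in> Obj (HMod H)"
    using left_hmodule_conj[OF H bar] by (simp add: HMod_def)
  show "conj_map bar bar X (Ident (HMod H) X) = Ident (HMod H) (conj_hmodule H bar X)"
    using bar by (auto simp: HMod_def conj_map_def the_inv_f_f intro!: restrict_ext)
next
  fix X Y :: "('h, 'v) hmodule" and f
  assume "X \<in> Obj (HMod H)" "f \<in> Hom (HMod H) X Y"
  then show "conj_map bar bar X f \<in> Hom (HMod H) (conj_hmodule H bar X) (conj_hmodule H bar Y)"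
    using conj_map_hmod_hom[OF H bar bar] by (simp add: HMod_def)
next
  fix X Y Z :: "('h, 'v) hmodule" and f g
  assume "f \<in> Hom (HMod H) X Y"
  then have "f \<in> carrier X \<rightarrow> carrier Y"
    by (auto simp: HMod_def hmod_hom_def lin_hom_def)
  then show "conj_map bar bar X (Comp (HMod H) X Y Z g f) =
      Comp (HMod H) (conj_hmodule H bar X) (conj_hmodule H bar Y) (conj_hmodule H bar Z)
        (conj_map bar bar Y g) (conj_map bar bar X f)"
    using bar by (auto simp: HMod_def conj_map_def compose_def the_inv_f_f Pi_iff intro!: restrict_ext)
qed

theorem proposition4p3:
  fixes H :: "'h hopf_star" and V W :: "('h, 'v) hmodule" and bar :: "'v \<Rightarrow> 'v"
  assumes "hopf_star_algebra H"
    and "inj bar"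
    and "left_hmodule H V" and "left_hmodule H W"
  shows "left_hmodule H (conj_hmodule H bar V) \<and>
    (\<forall>T \<in> hmod_hom H V W.
       conj_map bar bar V T \<in> hmod_hom H (conj_hmodule H bar V) (conj_hmodule H bar W)) \<and>
    endofunctor (HMod H :: (('h, 'v) hmodule, 'v \<Rightarrow> 'v) category)
      (conj_hmodule H bar) (\<lambda>V W. conj_map bar bar V)"
  using left_hmodule_conj[OF assms(1-3)] conj_map_hmod_hom[OF assms(1,2,2,3)]
    endofunctor_conj[OF assms(1,2)] by blast

end
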